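(* Let $n\ge 1$ be an integer, $0<s<1$ and $1<p<+\infty$. Let $u\in C^{2s+\epsilon,s+\epsilon}_{x,t,\mathrm{loc}}(\mathbb{R}^n\times\mathbb{R})\cap\mathcal{L}(\mathbb{R}^n\times\mathbb{R})$, for some $\epsilon>0$, be a positive bounded classical solution of $$(\partial_t-\Delta)^s u(x,t)=x_1u^p(x,t)\quad\text{in } \mathbb{R}^n\times\mathbb{R},$$ where $x=(x_1,\dots,x_n)$. Then for each $t\in\mathbb{R}$ the function $u(\cdot,t)$ is strictly monotone increasing in the $x_1$ direction, i.e. $u(x_1,x',t)<u(y_1,x',t)$ whenever $x_1<y_1$ and $x'\in\mathbb{R}^{n-1}$.
   Context: For $0<s<1$ the fully fractional heat (master) operator is $$(\partial_t-\Delta)^s u(x,t):=C_{n,s}\int_{-\infty}^{t}\int_{\mathbb{R}^n}\frac{u(x,t)-u(y,\tau)}{(t-\tau)^{\frac n2+1+s}}\,e^{-\frac{|x-y|^2}{4(t-\tau)}}\,dy\,d\tau,\qquad C_{n,s}=\frac{1}{(4\pi)^{n/2}|\Gamma(-s)|},$$ where the integral in $y$ is in the sense of Cauchy principal value. $\mathcal{L}(\mathbb{R}^n\times\mathbb{R})$ is the set of $u\in L^1_{\mathrm{loc}}(\mathbb{R}^n\times\mathbb{R})$ such that $\int_{-\infty}^t\int_{\mathbb{R}^n}\frac{|u(x,\tau)|e^{-|x|^2/(4(t-\tau))}}{1+(t-\tau)^{\frac n2+1+s}}\,dx\,d\tau<\infty$ for every $t\in\mathbb{R}$. Parabolic Hölder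 spaces $C^{2\alpha,\alpha}_{x,t}(\mathbb{R}^n\times\mathbb{R})$: (i) for $0<\alpha\le\frac12$, $u$ belongs to it if there is $C>0$ with $|u(x,t)-u(y,\tau)|\le C(|x-y|+|t-\tau|^{1/2})^{2\alpha}$ for all $x,y\in\mathbb{R}^n$, $t,\tau\in\mathbb{R}$; (ii) for $\frac12<\alpha\le1$, if $u$ is $\alpha$-Hölder continuous in $t$ uniformly in $x$, and $\nabla_x u$ is $(2\alpha-1)$-Hölder continuous in $x$ uniformly in $t$ and $(\alpha-\frac12)$-Hölder continuous in $t$ uniformly in $x$; (iii) for $\alpha>1$, if $\partial_tu, D_x^2u\in C^{2\alpha-2,\alpha-1}_{x,t}(\mathbb{R}^n\times\mathbb{R})$. The local space $C^{2\alpha,\alpha}_{x,t,\mathrm{loc}}$ is defined analogously, with the conditions required on bounded subsets of $\mathbb{R}^n\times\mathbb{R}$. The condition "$u\in C^{2s+\epsilon,s+\epsilon}_{x,t,\mathrm{loc}}(\mathbb{R}^n\times\mathbb{R})$ for some $\epsilon>0$" means $u\in C^{2\alpha,\alpha}_{x,t,\mathrm{loc}}(\mathbb{R}^n\times\mathbb{R})$ for some $\alpha>s$. A classical (entire) solution is a function $u\in C^{2s+\epsilon,s+\epsilon}_{x,t,\mathrm{loc}}(\mathbb{R}^n\times\mathbb{R})\cap\mathcal{L}(\mathbb{R}^n\times\mathbb{R})$ for some $\epsilon>0$ satisfying the equation at every point of $\mathbb{R}^n\times\mathbb{R}$. Positive means $u>0$ everywhere; bounded means $\sup_{\mathbb{R}^n\times\mathbb{R}}u<\infty$.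 *)

theory Defs
  imports "HOL-Analysis.Analysis"
begin

text \<open>Functions on \<open>\<real>\<^sup>n \<times> \<real>\<close> are curried: \<open>u x t\<close> with \<open>x :: real ^ 'n\<close> and \<open>n = CARD('n)\<close>.\<close>

definition has_pv_integral :: "('a::euclidean_space \<Rightarrow> real) \<Rightarrow> real \<Rightarrow> 'a \<Rightarrow> bool"
  where "has_pv_integral f I x \<longleftrightarrow>
    (\<forall>\<epsilon>>0. f absolutely_integrable_on (- ball x \<epsilon>)) \<and>
    ((\<lambda>\<epsilon>. integral (- ball x \<epsilon>) f) \<longlongrightarrow> I) (at_right 0)"

definition master_const :: "'n::finite itself \<Rightarrow> real \<Rightarrow> real"
  where "master_const _ s = 1 / ((4 * pi) powr (real CARD('n) / 2) * \<bar>Gamma (- s)\<bar>)"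

text \<open>\<open>has_master s u x t v\<close> states that the iterated integral defining
  \<open>(\<partial>\<^sub>t - \<Delta>)\<^sup>s u (x, t)\<close> converges and has the value \<open>v\<close>; \<open>J \<tau>\<close> is the inner integral
  in \<open>y\<close>, a principal value at \<open>y = x\<close>, which the outer integral needs only for almost
  every \<open>\<tau> < t\<close>.\<close>

definition has_master ::
    "real \<Rightarrow> (real ^ 'n \<Rightarrow> real \<Rightarrow> real) \<Rightarrow> real ^ 'n \<Rightarrow> real \<Rightarrow> real \<Rightarrow> bool"
  where "has_master s u x t v \<longleftrightarrow> (\<exists>J.
    (AE \<tau> in lebesgue. \<tau> < t \<longrightarrow>
      has_pv_integral
        (\<lambda>y. (u x t - u y \<tau>) / (t - \<tau>) powr (real CARD('n) / 2 + 1 + s)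
              * exp (- (norm (x - y))\<^sup>2 / (4 * (t - \<tau>))))
        (J \<tau>) x) \<and>
    J absolutely_integrable_on {..<t} \<and>
    v = master_const TYPE('n) s * integral {..<t} J)"

text \<open>The space \<open>\<L>(\<real>\<^sup>n \<times> \<real>)\<close>, which depends on \<open>s\<close>.\<close>

definition slow_growth :: "real \<Rightarrow> (real ^ 'n \<Rightarrow> real \<Rightarrow> real) set"
  where "slow_growth s = {u.
    (\<forall>K. compact K \<longrightarrow> (\<lambda>(x, t). u x t) absolutely_integrable_on K) \<and>
    (\<forall>t. (\<integral>\<^sup>+\<tau>\<in>{..<t}. (\<integral>\<^sup>+x.
        ennreal (\<bar>u x \<tau>\<bar> * exp (- (norm x)\<^sup>2 / (4 * (t - \<tau>)))
                  / (1 + (t - \<tau>) powr (real CARD('n) / 2 + 1 + s))) \<partial>lebesgue) \<partial>lebesgue) < \<infinity>)}"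

definition has_x_gradient ::
    "(real ^ 'n \<Rightarrow> real \<Rightarrow> real) \<Rightarrow> (real ^ 'n \<Rightarrow> real \<Rightarrow> real ^ 'n) \<Rightarrow> bool"
  where "has_x_gradient u g \<longleftrightarrow>
    (\<forall>x t. ((\<lambda>z. u z t) has_derivative (\<lambda>h. g x t \<bullet> h)) (at x))"

text \<open>\<open>parabolic_holder_loc \<alpha> u\<close> is \<open>u \<in> C\<^sup>2\<^sup>\<alpha>\<^sup>,\<^sup>\<alpha>\<close>, locally: derivatives exist
  everywhere, Hoelder constants may depend on the bounded set \<open>B\<close>. For \<open>\<alpha> > 1\<close> the
  definition recurses on \<open>\<alpha> - 1\<close>, since \<open>(2\<alpha> - 2, \<alpha> - 1) = (2(\<alpha> - 1), \<alpha> - 1)\<close>;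
  \<open>H x t $ i $ j\<close> are the entries of the Hessian \<open>D\<^sub>x\<^sup>2 u\<close>.\<close>

inductive parabolic_holder_loc :: "real \<Rightarrow> (real ^ 'n \<Rightarrow> real \<Rightarrow> real) \<Rightarrow> bool"
where
  low: "parabolic_holder_loc \<alpha> u"
  if "0 < \<alpha>" "\<alpha> \<le> 1 / 2"
    and "\<And>B :: ((real ^ 'n) \<times> real) set. bounded B \<Longrightarrow>
      \<exists>C>0. \<forall>x t y \<tau>. (x, t) \<in> B \<longrightarrow> (y, \<tau>) \<in> B \<longrightarrow>
        \<bar>u x t - u y \<tau>\<bar> \<le> C * (norm (x - y) + \<bar>t - \<tau>\<bar> powr (1 / 2)) powr (2 * \<alpha>)"
| mid: "parabolic_holder_loc \<alpha> u"
  if "1 / 2 < \<alpha>" "\<alpha> \<le> 1"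
    and "has_x_gradient u g"
    and "\<And>B :: ((real ^ 'n) \<times> real) set. bounded B \<Longrightarrow>
      \<exists>C>0. \<forall>x t \<tau>. (x, t) \<in> B \<longrightarrow> (x, \<tau>) \<in> B \<longrightarrow>
        \<bar>u x t - u x \<tau>\<bar> \<le> C * \<bar>t - \<tau>\<bar> powr \<alpha>"
    and "\<And>B :: ((real ^ 'n) \<times> real) set. bounded B \<Longrightarrow>
      \<exists>C>0. \<forall>x y t. (x, t) \<in> B \<longrightarrow> (y, t) \<in> B \<longrightarrow>
        norm (g x t - g y t) \<le> C * norm (x - y) powr (2 * \<alpha> - 1)"
    and "\<And>B :: ((real ^ 'n) \<times> real) set. bounded B \<Longrightarrow>
      \<exists>C>0. \<forall>x t \<tau>. (x, t) \<in> B \<longrightarrow> (x, \<tau>) \<in> B \<longrightarrow>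
        norm (g x t - g x \<tau>) \<le> C * \<bar>t - \<tau>\<bar> powr (\<alpha> - 1 / 2)"
| high: "parabolic_holder_loc \<alpha> u"
  if "1 < \<alpha>"
    and "\<And>x t. ((\<lambda>\<tau>. u x \<tau>) has_real_derivative ut x t) (at t)"
    and "parabolic_holder_loc (\<alpha> - 1) ut"
    and "has_x_gradient u g"
    and "\<And>i. has_x_gradient (\<lambda>x t. g x t $ i) (\<lambda>x t. H x t $ i)"
    and "\<And>i j. parabolic_holder_loc (\<alpha> - 1) (\<lambda>x t. H x t $ i $ j)"

text \<open>Classical entire solution of \<open>(\<partial>\<^sub>t - \<Delta>)\<^sup>s u (x, t) = f x t (u x t)\<close>.\<close>

definition classical_solution ::
    "real \<Rightarrow> (real ^ 'n \<Rightarrow> real \<Rightarrow> real \<Rightarrow> real) \<Rightarrow> (real ^ 'n \<Rightarrow> real \<Rightarrow> real) \<Rightarrow> bool"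
  where "classical_solution s f u \<longleftrightarrow>
    (\<exists>\<alpha>>s. parabolic_holder_loc \<alpha> u) \<and> u \<in> slow_growth s \<and>
    (\<forall>x t. has_master s u x t (f x t (u x t)))"

end

theory Submission
  imports Defs "HOL-Probability.Probability"
begin

text \<open>For \<open>\<tau> < t\<close> the inner integral is not singular, and substituting \<open>y = x + \<surd>r z\<close>,
  \<open>\<tau> = t - r\<close> turns the operator into a positive multiple of
  \<open>\<integral>\<^sub>0\<^sup>\<infinity> r\<^sup>-\<^sup>1\<^sup>-\<^sup>s (u(x,t) - E u(x + \<surd>r Z, t - r)) dr\<close> with a Gaussian \<open>Z\<close>. Let
  \<open>w\<^sub>l\<close> be the value of \<open>u\<close> at the mirror image in \<open>{x\<^sub>1 = l}\<close> minus \<open>u\<close>, and suppose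
  \<open>inf w\<^sub>l = -m < 0\<close> over \<open>{x\<^sub>1 < l}\<close>. The infimum need not be attained, so a small bump is
  added; at the resulting minimum, at distance \<open>d\<close> from the mirror, antisymmetry makes the
  operator applied to \<open>w\<^sub>l\<close> at most \<open>-c m d\<^sup>-\<^sup>2\<^sup>s + o(1)\<close>, while the equation gives
  \<open>2 d u\<^sub>l\<^sup>p + x\<^sub>1 (u\<^sub>l\<^sup>p - u\<^sup>p)\<close> for it, where \<open>u\<^sub>l\<close> is the mirrored \<open>u\<close>. This is
  contradictory if \<open>x\<^sub>1 \<le> 0\<close>; if
  \<open>0 < x\<^sub>1 < l \<le> \<Lambda>\<close>, it bounds \<open>u\<close> and \<open>d\<close> from below by constants and hence
  forces \<open>m \<ge> \<delta>(\<Lambda>)\<close>. As \<open>u\<close> is uniformly continuous in \<open>x\<^sub>1\<close> on slabs, \<open>m\<close> cannot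
  jump from \<open>0\<close> to \<open>\<delta>\<close> when the mirror moves by a small fixed amount, so no translated
  limits of \<open>u\<close> are needed. Finally \<open>w\<^sub>l = 0\<close> at a point would make the operator nonpositive
  there, against the value \<open>2 d u\<^sup>p > 0\<close>.\<close>

section \<open>The Gaussian measure\<close>

text \<open>The integrand factors over the coordinates into multiples of one-dimensional normal
  densities of variance \<open>1 / (2 * a)\<close>.\<close>

lemma integrable_exp_norm_square:
  fixes a :: real
  assumes "0 < a"
  shows "integrable (lborel :: 'a::euclidean_space measure) (\<lambda>z. exp (- a * (norm z)\<^sup>2))"
proof -
  interpret product_sigma_finite "\<lambda>_::'a. lborel :: real measure" ..
  define \<sigma> where "\<sigma> = sqrt (1 / (2 * a))"
  have \<sigma>: "0 < \<sigma>" "2 * \<sigma>\<^sup>2 = 1 / a" using assms by (auto simp: \<sigma>_def)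
  have "integrable lborel (\<lambda>x. sqrt (2 * pi * \<sigma>\<^sup>2) * normal_density 0 \<sigma> x)"
    using \<sigma> by (intro integrable_mult_right integrable_normal_density)
  also have "(\<lambda>x. sqrt (2 * pi * \<sigma>\<^sup>2) * normal_density 0 \<sigma> x) = (\<lambda>x. exp (- a * x\<^sup>2))"
    using \<sigma> assms by (auto simp: normal_density_def field_simps)
  finally have one: "integrable lborel (\<lambda>x::real. exp (- a * x\<^sup>2))" .
  have "integrable (\<Pi>\<^sub>M b\<in>Basis. lborel) (\<lambda>f. \<Prod>b\<in>(Basis::'a set). exp (- a * (f b)\<^sup>2))"
    using one by (intro product_integrable_prod) auto
  also have "(\<lambda>f. \<Prod>b\<in>(Basis::'a set). exp (- a * (f b)\<^sup>2)) =
      (\<lambda>f. exp (- a * (norm (\<Sum>b\<in>(Basis::'a set). f b *\<^sub>R b))\<^sup>2))"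
  proof
    fix f :: "'a \<Rightarrow> real"
    have "(norm (\<Sum>b\<in>(Basis::'a set). f b *\<^sub>R b))\<^sup>2 = (\<Sum>b\<in>(Basis::'a set). (f b)\<^sup>2)"
      by (subst norm_sum_Pythagorean) (auto simp: pairwise_def orthogonal_def inner_Basis)
    then show "(\<Prod>b\<in>(Basis::'a set). exp (- a * (f b)\<^sup>2)) =
        exp (- a * (norm (\<Sum>b\<in>(Basis::'a set). f b *\<^sub>R b))\<^sup>2)"
      by (simp add: exp_sum[symmetric] sum_distrib_left sum_negf)
  qed
  finally show ?thesis
    by (subst lborel_eq) (subst integrable_distr_eq, auto)
qed

text \<open>The heat kernel at time 1 up to its constant factor (variance 2 per coordinate): the
  substitution \<open>y = x + sqrt r *\<^sub>R z\<close> turns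
  \<open>exp (- (norm (x - y))\<^sup>2 / (4 * r))\<close> into exactly this weight.\<close>

definition gauss_weight :: "'a::euclidean_space \<Rightarrow> real"
  where "gauss_weight z = exp (- (norm z)\<^sup>2 / 4)"

definition gauss_mass :: "'a::euclidean_space itself \<Rightarrow> real"
  where "gauss_mass _ = (\<integral>(z::'a). gauss_weight z \<partial>lborel)"

definition gauss :: "'a::euclidean_space measure"
  where "gauss = density lborel (\<lambda>z. ennreal (gauss_weight z / gauss_mass TYPE('a)))"

lemma gauss_weight_pos [simp]: "0 < gauss_weight z"
  by (simp add: gauss_weight_def)

lemma gauss_weight_measurable [measurable]: "gauss_weight \<in> borel_measurable borel"
  unfolding gauss_weight_def by measurable

lemma gauss_weight_integrable: "integrable lborel (gauss_weight :: 'a::euclidean_space \<Rightarrow> real)"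
  using integrable_exp_norm_square[of "1/4", where 'a='a] by (simp add: gauss_weight_def[abs_def])

lemma gauss_mass_pos: "0 < gauss_mass TYPE('a::euclidean_space)"
proof -
  have "gauss_mass TYPE('a) \<noteq> 0"
  proof
    assume "gauss_mass TYPE('a) = 0"
    then have "AE (z::'a) in lborel. gauss_weight z = 0"
      unfolding gauss_mass_def
      by (subst (asm) integral_nonneg_eq_0_iff_AE[OF gauss_weight_integrable]) (auto simp: less_imp_le)
    then have "AE (z::'a) in lborel. False"
      by eventually_elim (use gauss_weight_pos in \<open>auto simp: less_le\<close>)
    then show False by (simp add: AE_iff_null null_sets_def emeasure_lborel_UNIV)
  qed
  moreover have "0 \<le> gauss_mass TYPE('a)"
    unfolding gauss_mass_def by (intro Bochner_Integration.integral_nonneg) (simp add: less_imp_le)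
  ultimately show ?thesis by simp
qed

lemma sets_gauss [simp, measurable_cong]: "sets gauss = sets borel"
  by (simp add: gauss_def)

lemma space_gauss [simp]: "space gauss = UNIV"
  by (simp add: gauss_def)

lemma integrable_gauss_iff:
  fixes f :: "'a::euclidean_space \<Rightarrow> real"
  assumes [measurable]: "f \<in> borel_measurable borel"
  shows "integrable gauss f \<longleftrightarrow> integrable lborel (\<lambda>z. gauss_weight z * f z)"
proof -
  have "integrable gauss f \<longleftrightarrow> integrable lborel (\<lambda>z. (gauss_weight z / gauss_mass TYPE('a)) *\<^sub>R f z)"
    unfolding gauss_def using gauss_mass_pos[where 'a='a]
    by (intro integrable_density) (auto simp: less_imp_le)
  also have "(\<lambda>z. (gauss_weight z / gauss_mass TYPE('a)) *\<^sub>R f z) =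
      (\<lambda>z. (1 / gauss_mass TYPE('a)) * (gauss_weight z * f z))"
    by (simp add: field_simps)
  also have "integrable lborel \<dots> \<longleftrightarrow> integrable lborel (\<lambda>z. gauss_weight z * f z)"
    using gauss_mass_pos[where 'a='a] by (subst integrable_mult_left_iff) simp
  finally show ?thesis .
qed

lemma integral_gauss:
  fixes f :: "'a::euclidean_space \<Rightarrow> real"
  assumes [measurable]: "f \<in> borel_measurable borel"
  shows "(\<integral>z. f z \<partial>gauss) = (\<integral>z. gauss_weight z * f z \<partial>lborel) / gauss_mass TYPE('a)"
proof -
  have "(\<integral>z. f z \<partial>gauss) = (\<integral>z. (1 / gauss_mass TYPE('a)) * (gauss_weight z * f z) \<partial>lborel)"
    unfolding gauss_def using gauss_mass_pos[where 'a='a]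
    by (subst integral_density) (auto simp: less_imp_le)
  then show ?thesis by simp
qed

lemma prob_space_gauss: "prob_space (gauss :: 'a::euclidean_space measure)"
proof
  have "emeasure (gauss :: 'a measure) (space gauss) =
      (\<integral>\<^sup>+(z::'a). ennreal (gauss_weight z / gauss_mass TYPE('a)) \<partial>lborel)"
    unfolding gauss_def by (simp add: emeasure_density)
  also have "\<dots> = ennreal (\<integral>(z::'a). gauss_weight z / gauss_mass TYPE('a) \<partial>lborel)"
    using gauss_mass_pos[where 'a='a]
    by (intro nn_integral_eq_integral) (auto simp: less_imp_le gauss_weight_integrable)
  also have "(\<integral>(z::'a). gauss_weight z / gauss_mass TYPE('a) \<partial>lborel) = 1"
    using gauss_mass_pos[where 'a='a] by (simp add: gauss_mass_def)
  finally show "emeasure (gauss :: 'a measure) (space gauss) = 1" by simp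
qed

lemma integrable_gauss_bounded:
  fixes f :: "'a::euclidean_space \<Rightarrow> real"
  assumes "f \<in> borel_measurable borel" and "\<And>z. \<bar>f z\<bar> \<le> B"
  shows "integrable gauss f"
proof -
  interpret prob_space "gauss :: 'a measure" by (rule prob_space_gauss)
  show ?thesis
    by (rule integrable_const_bound[where B=B]) (use assms in \<open>auto simp: measurable_def\<close>)
qed

lemma integrable_gauss_norm_square: "integrable gauss (\<lambda>z::'a::euclidean_space. (norm z)\<^sup>2)"
proof -
  have "integrable lborel (\<lambda>z::'a. gauss_weight z * (norm z)\<^sup>2)"
  proof (rule Bochner_Integration.integrable_bound)
    show "integrable lborel (\<lambda>z::'a. 8 * exp (- (1/8) * (norm z)\<^sup>2))"
      by (intro integrable_mult_right integrable_exp_norm_square) simp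
    have "gauss_weight z * (norm z)\<^sup>2 \<le> 8 * exp (- (1/8) * (norm z)\<^sup>2)" for z :: 'a
    proof -
      have "(norm z)\<^sup>2 \<le> 8 * exp ((norm z)\<^sup>2 / 8)"
        using exp_ge_add_one_self[of "(norm z)\<^sup>2 / 8"] by linarith
      then have "gauss_weight z * (norm z)\<^sup>2 \<le> gauss_weight z * (8 * exp ((norm z)\<^sup>2 / 8))"
        by (intro mult_left_mono) (simp_all add: less_imp_le)
      also have "\<dots> = 8 * exp (- (1/8) * (norm z)\<^sup>2)"
        by (simp add: gauss_weight_def exp_add[symmetric])
      finally show ?thesis .
    qed
    then show "AE (z::'a) in lborel. norm (gauss_weight z * (norm z)\<^sup>2) \<le>
        norm (8 * exp (- (1/8) * (norm z)\<^sup>2))"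
      by (auto simp: less_imp_le abs_mult)
  qed auto
  then show ?thesis by (subst integrable_gauss_iff) auto
qed

section \<open>Reflections and translations of the Gaussian measure\<close>

definition reflect :: "'a::euclidean_space \<Rightarrow> real \<Rightarrow> 'a \<Rightarrow> 'a"
  where "reflect e c z = z + (2 * (c - z \<bullet> e)) *\<^sub>R e"

lemma reflect_inner [simp]: "e \<in> Basis \<Longrightarrow> reflect e c z \<bullet> e = 2 * c - z \<bullet> e"
  by (simp add: reflect_def inner_add_left)

lemma reflect_reflect [simp]: "e \<in> Basis \<Longrightarrow> reflect e c (reflect e c z) = z"
  by (simp add: reflect_def inner_add_left algebra_simps)

lemma continuous_on_reflect [continuous_intros]: "continuous_on S (reflect e c)"
  unfolding reflect_def by (intro continuous_intros)

lemma reflect_measurable [measurable]: "reflect e c \<in> borel_measurable borel"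
  by (intro borel_measurable_continuous_onI continuous_intros)

text \<open>In coordinates the map is affine with diagonal entries 1 and -1, so its Jacobian has
  absolute value 1.\<close>

lemma lborel_distr_reflect:
  fixes e :: "'a::euclidean_space"
  assumes "e \<in> Basis"
  shows "distr lborel borel (reflect e c) = lborel"
proof -
  let ?k = "\<lambda>j. if j = e then - 1 else (1::real)"
  have *: "reflect e c = (\<lambda>x. (2 * c) *\<^sub>R e + (\<Sum>j\<in>Basis. (?k j * (x \<bullet> j)) *\<^sub>R j))"
  proof (rule ext, rule euclidean_eqI)
    fix x i :: 'a assume i: "i \<in> Basis"
    show "reflect e c x \<bullet> i = ((2 * c) *\<^sub>R e + (\<Sum>j\<in>Basis. (?k j * (x \<bullet> j)) *\<^sub>R j)) \<bullet> i"
      using assms i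
      by (simp add: reflect_def inner_add_left inner_sum_left_Basis inner_Basis)
  qed
  have "(\<Prod>j\<in>(Basis::'a set). \<bar>?k j\<bar>) = 1" by (intro prod.neutral) auto
  then show ?thesis
    using lborel_affine_euclidean[of ?k "(2 * c) *\<^sub>R e"] unfolding *[symmetric]
    by (simp add: density_1)
qed

lemma integral_gauss_inner: "(\<integral>z. z \<bullet> a \<partial>gauss) = 0"
proof -
  let ?I = "\<integral>z. gauss_weight z * (z \<bullet> a) \<partial>lborel"
  have lb: "distr lborel borel uminus = (lborel :: 'a measure)"
    using lborel_affine[of "- 1" "0 :: 'a"] by (simp add: density_1)
  have "?I = (\<integral>z. gauss_weight z * (z \<bullet> a) \<partial>distr lborel borel uminus)"
    by (simp only: lb)
  also have "\<dots> = (\<integral>z. gauss_weight (- z) * (- z \<bullet> a) \<partial>lborel)"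
    by (subst integral_distr) auto
  also have "\<dots> = - ?I"
    by (simp add: gauss_weight_def)
  finally show ?thesis by (subst integral_gauss) auto
qed

lemma norm_reflect_square:
  assumes "e \<in> Basis"
  shows "(norm (reflect e c z))\<^sup>2 = (norm z)\<^sup>2 + 4 * c * (c - z \<bullet> e)"
proof -
  have "(norm (reflect e c z))\<^sup>2 = (norm z)\<^sup>2 + 2 * (2 * (c - z \<bullet> e)) * (z \<bullet> e) + (2 * (c - z \<bullet> e))\<^sup>2"
    using assms unfolding reflect_def power2_norm_eq_inner
    by (simp add: inner_add_left inner_add_right inner_commute power2_eq_square)
  then show ?thesis by (simp add: power2_eq_square algebra_simps)
qed

text \<open>After symmetrising, the integrand is \<open>\<phi>\<close> times the difference of the Gaussian weights at a
  point and at its mirror image, and both factors change sign across the mirror.\<close>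

lemma integral_gauss_antisymmetric_nonneg:
  fixes \<phi> :: "'a::euclidean_space \<Rightarrow> real"
  assumes e: "e \<in> Basis" and c: "0 \<le> c"
    and [measurable]: "\<phi> \<in> borel_measurable borel" and bound: "\<And>z. \<bar>\<phi> z\<bar> \<le> B"
    and anti: "\<And>z. \<phi> (reflect e c z) = - \<phi> z"
    and nonneg: "\<And>z. z \<bullet> e < c \<Longrightarrow> 0 \<le> \<phi> z"
  shows "0 \<le> (\<integral>z. \<phi> z \<partial>gauss)"
proof -
  let ?I = "\<integral>z. gauss_weight z * \<phi> z \<partial>lborel"
  let ?R = "reflect e c"
  have int: "integrable lborel (\<lambda>z. gauss_weight z * \<phi> z)"
    using integrable_gauss_bounded[of \<phi> B] bound by (subst integrable_gauss_iff[symmetric]) auto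
  have lb: "distr lborel borel ?R = lborel" by (rule lborel_distr_reflect[OF e])
  have "integrable (distr lborel borel ?R) (\<lambda>z. gauss_weight z * \<phi> z)"
    using int by (simp only: lb)
  then have "integrable lborel (\<lambda>z. gauss_weight (?R z) * \<phi> (?R z))"
    by (subst (asm) integrable_distr_eq) auto
  then have "integrable lborel (\<lambda>z. - (gauss_weight (?R z) * \<phi> (?R z)))"
    by (rule Bochner_Integration.integrable_minus)
  then have int': "integrable lborel (\<lambda>z. gauss_weight (?R z) * \<phi> z)"
    by (simp add: anti)
  have "?I = (\<integral>z. gauss_weight z * \<phi> z \<partial>distr lborel borel ?R)"
    by (simp only: lb)
  also have "\<dots> = (\<integral>z. gauss_weight (?R z) * \<phi> (?R z) \<partial>lborel)"
    by (subst integral_distr) auto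
  also have "\<dots> = - (\<integral>z. gauss_weight (?R z) * \<phi> z \<partial>lborel)"
    by (simp add: anti)
  finally have "2 * ?I = ?I - (\<integral>z. gauss_weight (?R z) * \<phi> z \<partial>lborel)" by simp
  also have "\<dots> = (\<integral>z. (gauss_weight z - gauss_weight (?R z)) * \<phi> z \<partial>lborel)"
    by (subst Bochner_Integration.integral_diff[OF int int', symmetric]) (simp add: left_diff_distrib)
  also have "0 \<le> \<dots>"
  proof (intro Bochner_Integration.integral_nonneg)
    fix z
    consider "z \<bullet> e < c" | "z \<bullet> e > c" | "z \<bullet> e = c" by linarith
    then show "0 \<le> (gauss_weight z - gauss_weight (?R z)) * \<phi> z"
    proof cases
      case 1
      then have "0 \<le> 4 * c * (c - z \<bullet> e)" using c by simp
      then show ?thesis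
        using nonneg[OF 1] norm_reflect_square[OF e, of c z] by (simp add: gauss_weight_def)
    next
      case 2
      then have "0 \<ge> 4 * c * (c - z \<bullet> e)" using c by (simp add: mult_nonneg_nonpos)
      moreover have "\<phi> z \<le> 0" using nonneg[of "?R z"] 2 e by (simp add: anti)
      ultimately show ?thesis
        using norm_reflect_square[OF e, of c z] by (intro mult_nonpos_nonpos) (auto simp: gauss_weight_def)
    next
      case 3
      then show ?thesis by (simp add: reflect_def)
    qed
  qed
  finally show ?thesis
    using gauss_mass_pos[where 'a='a] by (subst integral_gauss) auto
qed

text \<open>\<open>\<rho>\<close> is the density of the law of \<open>Z + b\<close> with respect to
  that of \<open>Z\<close>, found by completing the square in the exponent.\<close>

lemma integral_gauss_shift:
  fixes a :: "'a::euclidean_space \<Rightarrow> real" and b :: 'a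
  assumes [measurable]: "a \<in> borel_measurable borel" and bound: "\<And>z. \<bar>a z\<bar> \<le> B"
  defines "\<rho> \<equiv> \<lambda>z. exp ((2 * (z \<bullet> b) - (norm b)\<^sup>2) / 4)"
  shows "integrable gauss (\<lambda>z. a z * \<rho> z)"
    and "(\<integral>z. a (z + b) \<partial>gauss) = (\<integral>z. a z * \<rho> z \<partial>gauss)"
proof -
  have [measurable]: "\<rho> \<in> borel_measurable borel" unfolding \<rho>_def by measurable
  have lb: "distr lborel borel ((+) b) = lborel" by (rule lborel_distr_plus)
  have w: "gauss_weight z = gauss_weight (b + z) * \<rho> (b + z)" for z
    unfolding gauss_weight_def \<rho>_def exp_add[symmetric] power2_norm_eq_inner
    by (simp add: inner_add_left inner_add_right inner_commute field_simps)
  have int: "integrable lborel (\<lambda>z. gauss_weight z * a (z + b))"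
    using integrable_gauss_bounded[of "\<lambda>z. a (z + b)" B] bound
    by (subst integrable_gauss_iff[symmetric]) auto
  have eq: "(\<lambda>z. gauss_weight z * a (z + b)) =
      (\<lambda>z. gauss_weight (b + z) * (a (b + z) * \<rho> (b + z)))"
    by (subst w) (auto simp: add.commute mult_ac)
  have "integrable (distr lborel borel ((+) b)) (\<lambda>z. gauss_weight z * (a z * \<rho> z))"
    using int unfolding eq by (subst integrable_distr_eq) auto
  then show "integrable gauss (\<lambda>z. a z * \<rho> z)"
    unfolding lb by (subst integrable_gauss_iff) auto
  have "(\<integral>z. gauss_weight z * a (z + b) \<partial>lborel) =
      (\<integral>z. gauss_weight z * (a z * \<rho> z) \<partial>distr lborel borel ((+) b))"
    unfolding eq by (subst integral_distr) auto
  then show "(\<integral>z. a (z + b) \<partial>gauss) = (\<integral>z. a z * \<rho> z \<partial>gauss)"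
    unfolding lb by (subst (1 2) integral_gauss) auto
qed

text \<open>The \<open>L\<^sup>1\<close> distance of \<open>\<rho>\<close> to \<open>1\<close> is bounded through
  \<open>2 \<eta> \<bar>1 - \<rho>\<bar> \<le> \<eta>\<^sup>2 + (1 - \<rho>)\<^sup>2\<close>, because \<open>\<rho>\<^sup>2\<close> is a multiple of the density of the
  Gaussian shifted by \<open>2 b\<close>.\<close>

lemma integral_gauss_shift_diff_le:
  fixes a :: "'a::euclidean_space \<Rightarrow> real" and b :: 'a
  assumes [measurable]: "a \<in> borel_measurable borel" and bound: "\<And>z. \<bar>a z\<bar> \<le> B"
    and \<eta>: "0 < \<eta>"
  shows "\<bar>(\<integral>z. a z \<partial>gauss) - (\<integral>z. a (z + b) \<partial>gauss)\<bar> \<le>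
    B * (\<eta> / 2 + (exp ((norm b)\<^sup>2 / 2) - 1) / (2 * \<eta>))"
proof -
  interpret prob_space "gauss :: 'a measure" by (rule prob_space_gauss)
  define \<rho> where "\<rho> = (\<lambda>z. exp ((2 * (z \<bullet> b) - (norm b)\<^sup>2) / 4))"
  have \<rho>2: "(\<rho> z)\<^sup>2 = exp ((norm b)\<^sup>2 / 2) * exp ((2 * (z \<bullet> (2 *\<^sub>R b)) - (norm (2 *\<^sub>R b))\<^sup>2) / 4)" for z
    unfolding \<rho>_def exp_add[symmetric] power2_eq_square by (simp add: field_simps)
  \<comment> \<open>For the constant function 1, the shifts by \<open>b\<close> and
    \<open>2 *\<^sub>R b\<close> give the first and second moments of \<open>\<rho>\<close>.\<close>
  note shift = integral_gauss_shift[of "\<lambda>_. 1::real" 1, simplified]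
  have i1: "integrable gauss \<rho>" and I1: "(\<integral>z. \<rho> z \<partial>gauss) = 1"
    using shift[of b] prob_space by (simp_all add: \<rho>_def)
  have i2: "integrable gauss (\<lambda>z. (\<rho> z)\<^sup>2)" and I2: "(\<integral>z. (\<rho> z)\<^sup>2 \<partial>gauss) = exp ((norm b)\<^sup>2 / 2)"
    using shift[of "2 *\<^sub>R b"] prob_space unfolding \<rho>2 by (simp_all add: integrable_mult_right)
  have ia: "integrable gauss a" using integrable_gauss_bounded[of a B] bound by auto
  have ia\<rho>: "integrable gauss (\<lambda>z. a z * \<rho> z)"
    and Ia\<rho>: "(\<integral>z. a (z + b) \<partial>gauss) = (\<integral>z. a z * \<rho> z \<partial>gauss)"
    using integral_gauss_shift[of a B b] bound by (auto simp: \<rho>_def)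
  have B: "0 \<le> B" using bound[of 0] by linarith
  have "(\<integral>z. a z \<partial>gauss) - (\<integral>z. a (z + b) \<partial>gauss) = (\<integral>z. a z - a z * \<rho> z \<partial>gauss)"
    using ia ia\<rho> unfolding Ia\<rho> by simp
  also have "\<bar>\<dots>\<bar> \<le> (\<integral>z. \<bar>a z - a z * \<rho> z\<bar> \<partial>gauss)"
    by (rule integral_abs_bound)
  also have "\<dots> \<le> (\<integral>z. B * (\<eta> / 2 + (1 - 2 * \<rho> z + (\<rho> z)\<^sup>2) / (2 * \<eta>)) \<partial>gauss)"
  proof (rule integral_mono)
    show "integrable gauss (\<lambda>z. \<bar>a z - a z * \<rho> z\<bar>)" using ia ia\<rho> by auto
    show "integrable gauss (\<lambda>z. B * (\<eta> / 2 + (1 - 2 * \<rho> z + (\<rho> z)\<^sup>2) / (2 * \<eta>)))"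
      using i1 i2 by auto
    fix z
    define Q where "Q = 1 - 2 * \<rho> z + (\<rho> z)\<^sup>2"
    have "0 \<le> (\<bar>1 - \<rho> z\<bar> - \<eta>)\<^sup>2" by simp
    also have "\<dots> = Q - 2 * \<eta> * \<bar>1 - \<rho> z\<bar> + \<eta>\<^sup>2"
      unfolding power2_diff by (simp add: Q_def power2_diff)
    finally have "\<bar>1 - \<rho> z\<bar> \<le> \<eta> / 2 + Q / (2 * \<eta>)"
      using \<eta> by (simp add: field_simps power2_eq_square)
    then have "\<bar>1 - \<rho> z\<bar> \<le> \<eta> / 2 + (1 - 2 * \<rho> z + (\<rho> z)\<^sup>2) / (2 * \<eta>)"
      by (simp only: Q_def)
    then have "\<bar>a z\<bar> * \<bar>1 - \<rho> z\<bar> \<le> B * (\<eta> / 2 + (1 - 2 * \<rho> z + (\<rho> z)\<^sup>2) / (2 * \<eta>))"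
      using bound B by (intro mult_mono) auto
    then show "\<bar>a z - a z * \<rho> z\<bar> \<le> B * (\<eta> / 2 + (1 - 2 * \<rho> z + (\<rho> z)\<^sup>2) / (2 * \<eta>))"
      by (simp add: abs_mult[symmetric] algebra_simps)
  qed
  also have "\<dots> = B * (\<eta> / 2 + (exp ((norm b)\<^sup>2 / 2) - 1) / (2 * \<eta>))"
    using i1 i2 I1 I2 prob_space by (simp add: Bochner_Integration.integral_diff)
  finally show ?thesis .
qed

text \<open>The open half-space inside is not Lebesgue-null and the Gaussian density is positive.
  This mass later quantifies the gain from antisymmetry.\<close>

lemma gauss_halfspace_pos:
  assumes "e \<in> Basis"
  shows "0 < measure gauss {z. c \<le> z \<bullet> e}"
proof -
  interpret prob_space "gauss :: 'a measure" by (rule prob_space_gauss)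
  let ?S = "{z::'a. c < z \<bullet> e}"
  have "(c + 1) *\<^sub>R e \<in> ?S" using assms by simp
  then have ne: "?S \<noteq> {}" by blast
  have op: "open ?S" by (rule open_halfspace_component_gt)
  have "emeasure gauss ?S \<noteq> 0"
  proof
    have pos: "\<not> gauss_weight z \<le> 0" for z :: 'a by (simp add: not_le)
    assume "emeasure gauss ?S = 0"
    moreover have "?S \<in> sets gauss" using op by simp
    ultimately have "?S \<in> null_sets gauss" by (simp add: null_sets_def)
    then have "AE z in lborel. z \<in> ?S \<longrightarrow> ennreal (gauss_weight z / gauss_mass TYPE('a)) = 0"
      unfolding gauss_def by (subst (asm) null_sets_density_iff) auto
    then have "AE z in lborel. z \<notin> ?S"
      by eventually_elim (use gauss_mass_pos[where 'a='a] in \<open>simp add: ennreal_eq_0_iff divide_le_0_iff pos\<close>)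
    then have "?S \<in> null_sets lborel"
      using op by (subst AE_iff_null_sets) auto
    then have "?S = {}"
      using open_not_negligible[OF op] by (auto simp: negligible_iff_null_sets null_sets_completionI)
    then show False using ne by simp
  qed
  then have "0 < measure gauss ?S"
    by (simp add: emeasure_eq_measure zero_less_measure_iff)
  also have "\<dots> \<le> measure gauss {z. c \<le> z \<bullet> e}"
    by (intro finite_measure_mono) auto
  finally show ?thesis .
qed

section \<open>The heat average and the bump\<close>

text \<open>The value at \<open>(x, t)\<close> of the heat flow that starts from \<open>u\<close> at
  time \<open>t - r\<close> and runs for time \<open>r\<close>.\<close>

definition heat :: "('a::euclidean_space \<Rightarrow> real \<Rightarrow> real) \<Rightarrow> 'a \<Rightarrow> real \<Rightarrow> real \<Rightarrow> real"
  where "heat u x t r = (\<integral>z. u (x + sqrt r *\<^sub>R z) (t - r) \<partial>gauss)"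

text \<open>The squared parabolic distance to the centre, truncated at 1: zero at the centre,
  constant away from it, and smooth enough at small scales for the operator to stay bounded on
  it.\<close>

definition bump :: "'a::euclidean_space \<Rightarrow> real \<Rightarrow> 'a \<Rightarrow> real \<Rightarrow> real"
  where "bump x\<^sub>0 t\<^sub>0 x t = min 1 ((norm (x - x\<^sub>0))\<^sup>2 + \<bar>t - t\<^sub>0\<bar>)"

definition gauss_variance :: "'a::euclidean_space itself \<Rightarrow> real"
  where "gauss_variance _ = (\<integral>z. (norm (z::'a))\<^sup>2 \<partial>gauss)"

lemma gauss_variance_nonneg: "0 \<le> gauss_variance TYPE('a::euclidean_space)"
  unfolding gauss_variance_def by (intro Bochner_Integration.integral_nonneg) simp

lemma bump_nonneg: "0 \<le> bump x\<^sub>0 t\<^sub>0 x t" and bump_le_1: "bump x\<^sub>0 t\<^sub>0 x t \<le> 1"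
  and bump_center [simp]: "bump x\<^sub>0 t\<^sub>0 x\<^sub>0 t\<^sub>0 = 0"
  by (auto simp: bump_def)

lemma bump_measurable [measurable]: "(\<lambda>z. bump x\<^sub>0 t\<^sub>0 (x + c *\<^sub>R z) t) \<in> borel_measurable borel"
  unfolding bump_def by measurable

text \<open>For small \<open>r\<close> the square is expanded: the linear term averages to zero, the
  quadratic one gives the variance, and the time shift adds at most \<open>r\<close>. For
  \<open>1 \<le> r\<close> the bound \<open>bump \<le> 1\<close> suffices.\<close>

lemma heat_bump_le:
  fixes x x\<^sub>0 :: "'a::euclidean_space"
  assumes r: "0 < r"
  shows "heat (bump x\<^sub>0 t\<^sub>0) x t r \<le> bump x\<^sub>0 t\<^sub>0 x t + (1 + gauss_variance TYPE('a)) * min 1 r"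
proof -
  interpret prob_space "gauss :: 'a measure" by (rule prob_space_gauss)
  let ?V = "gauss_variance TYPE('a)"
  let ?q = "(norm (x - x\<^sub>0))\<^sup>2 + \<bar>t - t\<^sub>0\<bar>"
  have int: "integrable gauss (\<lambda>z. bump x\<^sub>0 t\<^sub>0 (x + sqrt r *\<^sub>R z) (t - r))"
    by (rule integrable_gauss_bounded[where B=1]) (auto simp: bump_nonneg bump_le_1)
  have int_inner: "integrable gauss (\<lambda>z::'a. z \<bullet> (x - x\<^sub>0))"
  proof (rule Bochner_Integration.integrable_bound)
    show "integrable gauss (\<lambda>z::'a. norm (x - x\<^sub>0) * (1 + (norm z)\<^sup>2))"
      using integrable_gauss_norm_square by auto
    have "\<bar>z \<bullet> (x - x\<^sub>0)\<bar> \<le> norm (x - x\<^sub>0) * (1 + (norm z)\<^sup>2)" for z :: 'a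
    proof -
      have "norm z \<le> 1 + (norm z)\<^sup>2"
        using zero_le_power2[of "norm z - 1"] by (simp add: power2_diff) (smt (verit) norm_ge_zero)
      then have "norm z * norm (x - x\<^sub>0) \<le> (1 + (norm z)\<^sup>2) * norm (x - x\<^sub>0)"
        by (intro mult_right_mono) auto
      then show ?thesis
        using Cauchy_Schwarz_ineq2[of z "x - x\<^sub>0"] by (simp add: mult.commute)
    qed
    then show "AE z::'a in gauss. norm (z \<bullet> (x - x\<^sub>0)) \<le> norm (norm (x - x\<^sub>0) * (1 + (norm z)\<^sup>2))"
      by (intro AE_I2) (simp add: abs_mult)
  qed auto
  have "heat (bump x\<^sub>0 t\<^sub>0) x t r \<le> (\<integral>z. 1 \<partial>(gauss::'a measure))"
    unfolding heat_def using int by (intro integral_mono) (auto simp: bump_le_1)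
  then have le_1: "heat (bump x\<^sub>0 t\<^sub>0) x t r \<le> 1" using prob_space by simp
  have "heat (bump x\<^sub>0 t\<^sub>0) x t r \<le>
      (\<integral>z. ?q + r + 2 * sqrt r * (z \<bullet> (x - x\<^sub>0)) + r * (norm (z::'a))\<^sup>2 \<partial>gauss)"
    unfolding heat_def
  proof (rule integral_mono[OF int])
    show "integrable gauss (\<lambda>z::'a. ?q + r + 2 * sqrt r * (z \<bullet> (x - x\<^sub>0)) + r * (norm z)\<^sup>2)"
      using int_inner integrable_gauss_norm_square by auto
    fix z :: 'a
    have "(norm (x + sqrt r *\<^sub>R z - x\<^sub>0))\<^sup>2 =
        (norm (x - x\<^sub>0))\<^sup>2 + 2 * sqrt r * (z \<bullet> (x - x\<^sub>0)) + (sqrt r)\<^sup>2 * (norm z)\<^sup>2"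
      unfolding power2_norm_eq_inner
      by (simp add: inner_add_left inner_add_right inner_diff_left inner_diff_right inner_commute
          power2_eq_square algebra_simps)
    then show "bump x\<^sub>0 t\<^sub>0 (x + sqrt r *\<^sub>R z) (t - r) \<le>
        ?q + r + 2 * sqrt r * (z \<bullet> (x - x\<^sub>0)) + r * (norm z)\<^sup>2"
      using r unfolding bump_def by auto
  qed
  also have "\<dots> = (\<integral>z. ?q + r + 2 * sqrt r * (z \<bullet> (x - x\<^sub>0)) \<partial>gauss) +
      (\<integral>z. r * (norm (z::'a))\<^sup>2 \<partial>gauss)"
    using int_inner integrable_gauss_norm_square by (intro Bochner_Integration.integral_add) auto
  also have "(\<integral>z. ?q + r + 2 * sqrt r * (z \<bullet> (x - x\<^sub>0)) \<partial>gauss) =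
      (\<integral>z. ?q + r \<partial>(gauss::'a measure)) + (\<integral>z. 2 * sqrt r * (z \<bullet> (x - x\<^sub>0)) \<partial>gauss)"
    using int_inner by (intro Bochner_Integration.integral_add) auto
  also have "\<dots> + (\<integral>z. r * (norm (z::'a))\<^sup>2 \<partial>gauss) = ?q + r + r * ?V"
    using integral_gauss_inner[of "x - x\<^sub>0"] prob_space by (simp add: gauss_variance_def)
  finally have le_q: "heat (bump x\<^sub>0 t\<^sub>0) x t r \<le> ?q + (1 + ?V) * r" by (simp add: algebra_simps)
  show ?thesis
  proof (cases "1 \<le> r")
    case True
    then have "1 \<le> (1 + ?V) * min 1 r" using gauss_variance_nonneg[where 'a='a] by simp
    then show ?thesis using le_1 bump_nonneg[of x\<^sub>0 t\<^sub>0 x t] by linarith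
  next
    case False
    then have "0 \<le> (1 + ?V) * r" using r gauss_variance_nonneg[where 'a='a] by simp
    then show ?thesis using False le_1 le_q by (auto simp: bump_def min_def)
  qed
qed

text \<open>Outside the unit box the bump equals 1, so by near-minimality the penalised function is
  there at least its value at the centre. The minimum over the compact box is therefore global on
  \<open>S\<close>.\<close>

lemma attains_min_plus_bump:
  fixes W :: "'a::euclidean_space \<Rightarrow> real \<Rightarrow> real"
  assumes W: "continuous_on UNIV (\<lambda>(x, t). W x t)" and S: "closed S" and "x\<^sub>0 \<in> S" and "0 \<le> \<epsilon>"
    and near: "\<And>x t. x \<in> S \<Longrightarrow> W x\<^sub>0 t\<^sub>0 - \<epsilon> \<le> W x t"
  obtains x t where "x \<in> S"
    and "\<And>y \<tau>. y \<in> S \<Longrightarrow> W x t + \<epsilon> * bump x\<^sub>0 t\<^sub>0 x t \<le> W y \<tau> + \<epsilon> * bump x\<^sub>0 t\<^sub>0 y \<tau>"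
proof -
  define K where "K = (S \<inter> cball x\<^sub>0 1) \<times> cball t\<^sub>0 1"
  define F where "F = (\<lambda>(x, t). W x t + \<epsilon> * bump x\<^sub>0 t\<^sub>0 x t)"
  have "compact K"
    unfolding K_def using S by (intro compact_Times closed_Int_compact) auto
  moreover have "K \<noteq> {}" using \<open>x\<^sub>0 \<in> S\<close> by (auto simp: K_def)
  moreover have "continuous_on K F"
    unfolding F_def bump_def split_def
    by (intro continuous_intros continuous_on_subset[OF W[unfolded split_def]]) auto
  ultimately obtain p where p: "p \<in> K" and min: "\<And>q. q \<in> K \<Longrightarrow> F p \<le> F q"
    using continuous_attains_inf[of K F] by blast
  obtain x t where pxt: "p = (x, t)" by fastforce
  show thesis
  proof
    show "x \<in> S" using p by (auto simp: K_def pxt)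
    fix y \<tau> assume "y \<in> S"
    show "W x t + \<epsilon> * bump x\<^sub>0 t\<^sub>0 x t \<le> W y \<tau> + \<epsilon> * bump x\<^sub>0 t\<^sub>0 y \<tau>"
    proof (cases "(y, \<tau>) \<in> K")
      case True
      then show ?thesis using min[of "(y, \<tau>)"] by (simp add: F_def pxt)
    next
      case False
      then have "1 < norm (y - x\<^sub>0) \<or> 1 < \<bar>\<tau> - t\<^sub>0\<bar>"
        using \<open>y \<in> S\<close> by (auto simp: K_def dist_norm norm_minus_commute dist_real_def)
      then have "1 \<le> (norm (y - x\<^sub>0))\<^sup>2 + \<bar>\<tau> - t\<^sub>0\<bar>"
      proof
        assume "1 < norm (y - x\<^sub>0)"
        then have "1 \<le> (norm (y - x\<^sub>0))\<^sup>2" by (simp add: one_le_power)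
        then show ?thesis by linarith
      next
        assume "1 < \<bar>\<tau> - t\<^sub>0\<bar>"
        then show ?thesis using zero_le_power2[of "norm (y - x\<^sub>0)"] by linarith
      qed
      then have "bump x\<^sub>0 t\<^sub>0 y \<tau> = 1" by (simp add: bump_def)
      moreover have "W x t + \<epsilon> * bump x\<^sub>0 t\<^sub>0 x t \<le> W x\<^sub>0 t\<^sub>0"
        using min[of "(x\<^sub>0, t\<^sub>0)"] \<open>x\<^sub>0 \<in> S\<close> by (simp add: F_def pxt K_def)
      ultimately show ?thesis using near[OF \<open>y \<in> S\<close>, of \<tau>] by simp
    qed
  qed
qed

section \<open>Integrals over the scales against the weight \<open>r powr (- 1 - s)\<close>\<close>

lemma has_integral_powr_min:
  assumes "0 < s" "s < 1"
  shows "((\<lambda>r::real. r powr (- 1 - s) * min 1 r) has_integral (1 / (1 - s) + 1 / s)) {0<..}"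
proof -
  have "((\<lambda>r::real. r powr (- s)) has_integral (1 / (1 - s))) {0..1}"
    using has_integral_powr_from_0[of "- s" 1] assms by simp
  then have 1: "((\<lambda>r::real. r powr (- 1 - s) * min 1 r) has_integral (1 / (1 - s))) {0..1}"
  proof (rule has_integral_eq[rotated])
    fix r :: real assume r: "r \<in> {0..1}"
    then have "r powr (- s) = r powr (- 1 - s) * r"
      using powr_mult_base[of r "- 1 - s"] by (simp add: mult.commute)
    then show "r powr (- s) = r powr (- 1 - s) * min 1 r" using r by simp
  qed
  have "((\<lambda>r::real. r powr (- 1 - s)) has_integral (1 / s)) {1..}"
    using has_integral_powr_to_inf[of "- 1 - s" 1] assms by simp
  then have 2: "((\<lambda>r::real. r powr (- 1 - s) * min 1 r) has_integral (1 / s)) {1..}"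
    by (rule has_integral_eq[rotated]) auto
  have "((\<lambda>r::real. r powr (- 1 - s) * min 1 r) has_integral (1 / (1 - s) + 1 / s)) ({0..1} \<union> {1..})"
    by (rule has_integral_Un[OF 1 2]) (rule negligible_subset[of "{1}"], auto)
  then show ?thesis
    by (subst (asm) has_integral_spike_set_eq[where T="{0<..}"])
      (auto intro: negligible_subset[of "{0}"])
qed

text \<open>Turns scale-by-scale bounds into a bound on the operator: \<open>A\<close> is the cost
  at all scales, \<open>B\<close> the gain at scales beyond \<open>\<rho>\<close>.\<close>

lemma integral_powr_le:
  fixes \<psi> :: "real \<Rightarrow> real"
  assumes s: "0 < s" "s < 1" and \<rho>: "0 < \<rho>"
    and int: "(\<lambda>r. r powr (- 1 - s) * \<psi> r) integrable_on {0<..}"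
    and le: "\<And>r. 0 < r \<Longrightarrow> \<psi> r \<le> A * min 1 r - (if \<rho> \<le> r then B else 0)"
  shows "integral {0<..} (\<lambda>r. r powr (- 1 - s) * \<psi> r) \<le>
    A * (1 / (1 - s) + 1 / s) - B * (\<rho> powr (- s) / s)"
proof -
  have "((\<lambda>r::real. r powr (- 1 - s)) has_integral (\<rho> powr (- s) / s)) {\<rho>..}"
    using has_integral_powr_to_inf[of "- 1 - s" \<rho>] s \<rho> by simp
  then have "((\<lambda>r::real. if r \<in> {\<rho>..} then r powr (- 1 - s) else 0) has_integral (\<rho> powr (- s) / s)) {0<..}"
    using \<rho> by (subst has_integral_restrict) auto
  note bound = has_integral_diff[OF has_integral_mult_right[OF has_integral_powr_min[OF s], of A]
      has_integral_mult_right[OF this, of B]]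
  show ?thesis
  proof (rule has_integral_le[OF integrable_integral[OF int] bound])
    fix r :: real assume r: "r \<in> {0<..}"
    have "r powr (- 1 - s) * \<psi> r \<le> r powr (- 1 - s) * (A * min 1 r - (if \<rho> \<le> r then B else 0))"
      using le[of r] r by (intro mult_left_mono) auto
    also have "\<dots> = A * (r powr (- 1 - s) * min 1 r) - B * (if r \<in> {\<rho>..} then r powr (- 1 - s) else 0)"
      by (auto simp: algebra_simps)
    finally show "r powr (- 1 - s) * \<psi> r \<le> A * (r powr (- 1 - s) * min 1 r) - B * (if r \<in> {\<rho>..} then r powr (- 1 - s) else 0)" .
  qed
qed

section \<open>The master operator as an integral of heat averages\<close>

text \<open>Substitution \<open>y = x + sqrt r *\<^sub>R z\<close>, whose Jacobian is the power of
  \<open>r\<close> in front.\<close>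

lemma lborel_integral_heat_kernel:
  fixes h :: "'a::euclidean_space \<Rightarrow> real" and x :: 'a
  assumes r: "0 < r" and [measurable]: "h \<in> borel_measurable borel" and bound: "\<And>y. \<bar>h y\<bar> \<le> B"
  defines "k \<equiv> \<lambda>y. h y * exp (- (norm (x - y))\<^sup>2 / (4 * r))"
  shows "integrable lborel k"
    and "(\<integral>y. k y \<partial>lborel) =
      r powr (real DIM('a) / 2) * gauss_mass TYPE('a) * (\<integral>z. h (x + sqrt r *\<^sub>R z) \<partial>gauss)"
proof -
  let ?T = "\<lambda>z. x + sqrt r *\<^sub>R z"
  let ?c = "sqrt r ^ DIM('a)"
  have [measurable]: "k \<in> borel_measurable borel" unfolding k_def by measurable
  have lb: "lborel = density (distr lborel borel ?T) (\<lambda>_. ennreal ?c)"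
    using lborel_affine[of "sqrt r" x] r by (simp add: ennreal_power)
  have kT: "k (?T z) = gauss_weight z * h (?T z)" for z
    using r by (simp add: k_def gauss_weight_def power_mult_distrib)
  have c: "0 < ?c" using r by simp
  have "integrable gauss (\<lambda>z. h (?T z))"
    using bound by (intro integrable_gauss_bounded[where B=B]) auto
  then have "integrable lborel (\<lambda>z. ?c * k (?T z))"
    unfolding kT by (subst (asm) integrable_gauss_iff) auto
  then show "integrable lborel k"
    using c by (subst lb, subst integrable_density) (auto simp: integrable_distr_eq)
  have "(\<integral>y. k y \<partial>lborel) = ?c * (\<integral>z. gauss_weight z * h (?T z) \<partial>lborel)"
    unfolding kT[symmetric] using c
    by (subst lb, subst integral_density) (auto simp: integral_distr)
  also have "?c = r powr (real DIM('a) / 2)"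
    using r by (simp add: powr_realpow[symmetric] powr_half_sqrt[symmetric] powr_powr)
  also have "(\<integral>z. gauss_weight z * h (?T z) \<partial>lborel) =
      gauss_mass TYPE('a) * (\<integral>z. h (?T z) \<partial>gauss)"
    using gauss_mass_pos[where 'a='a] by (subst integral_gauss) auto
  finally show "(\<integral>y. k y \<partial>lborel) =
      r powr (real DIM('a) / 2) * gauss_mass TYPE('a) * (\<integral>z. h (?T z) \<partial>gauss)"
    by simp
qed

text \<open>Dominated convergence over the complements of balls of radius
  \<open>1 / (k + 1)\<close>; only the null set \<open>{x}\<close> is lost in the limit.\<close>

lemma has_pv_integral_unique:
  fixes f :: "'a::euclidean_space \<Rightarrow> real"
  assumes f: "f absolutely_integrable_on UNIV" and pv: "has_pv_integral f I x"
  shows "I = integral UNIV f"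
proof -
  let ?\<epsilon> = "\<lambda>k::nat. inverse (real (Suc k))"
  let ?f = "\<lambda>k y. if y \<in> - ball x (?\<epsilon> k) then f y else 0"
  let ?g = "\<lambda>y. if y = x then 0 else f y"
  have \<epsilon>: "filterlim ?\<epsilon> (at_right 0) sequentially"
    unfolding filterlim_at
    using LIMSEQ_inverse_real_of_nat by auto
  have "((\<lambda>\<epsilon>. integral (- ball x \<epsilon>) f) \<longlongrightarrow> I) (at_right 0)"
    using pv by (simp add: has_pv_integral_def)
  from filterlim_compose[OF this \<epsilon>] have "(\<lambda>k. integral (- ball x (?\<epsilon> k)) f) \<longlonglongrightarrow> I" .
  then have 1: "(\<lambda>k. integral UNIV (?f k)) \<longlonglongrightarrow> I"
    by (simp only: integral_restrict_UNIV)
  have "(\<lambda>k. integral UNIV (?f k)) \<longlonglongrightarrow> integral UNIV ?g"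
  proof (rule dominated_convergence(2)[where h="\<lambda>y. \<bar>f y\<bar>"])
    show "(\<lambda>y. \<bar>f y\<bar>) integrable_on UNIV"
      using f by (auto simp: absolutely_integrable_on_def)
    fix k
    have "f absolutely_integrable_on - ball x (?\<epsilon> k)"
      using pv unfolding has_pv_integral_def by auto
    then show "?f k integrable_on UNIV"
      by (simp only: integrable_restrict_UNIV absolutely_integrable_on_def)
    fix y show "norm (?f k y) \<le> \<bar>f y\<bar>" by simp
  next
    fix y
    show "(\<lambda>k. ?f k y) \<longlonglongrightarrow> ?g y"
    proof (cases "y = x")
      case True
      then show ?thesis by (auto intro!: tendsto_eventually)
    next
      case False
      then have "\<forall>\<^sub>F k in sequentially. ?\<epsilon> k < dist x y"
        using order_tendstoD(2)[OF LIMSEQ_inverse_real_of_nat, of "dist x y"] by simp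
      then have "\<forall>\<^sub>F k in sequentially. ?f k y = f y"
        by eventually_elim auto
      then show ?thesis using False by (auto intro: tendsto_eventually)
    qed
  qed
  with 1 have "I = integral UNIV ?g" by (rule LIMSEQ_unique)
  also have "\<dots> = integral UNIV f"
    by (rule integral_spike[of "{x}"]) auto
  finally show ?thesis .
qed

text \<open>At each \<open>\<tau> < t\<close> the kernel is not singular, so the principal value is
  an ordinary integral. The Jacobian \<open>r powr (n / 2)\<close> against
  \<open>r powr (n / 2 + 1 + s)\<close> leaves the weight \<open>r powr (- 1 - s)\<close>.\<close>

lemma has_master_heat:
  fixes u :: "real ^ 'n \<Rightarrow> real \<Rightarrow> real"
  assumes cont: "continuous_on UNIV (\<lambda>(x, t). u x t)" and bound: "\<And>x t. \<bar>u x t\<bar> \<le> M"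
    and master: "has_master s u x t v"
  defines "\<psi> \<equiv> \<lambda>r. r powr (- 1 - s) * (u x t - heat u x t r)"
  shows "\<psi> integrable_on {0<..}"
    and "v = master_const TYPE('n) s * gauss_mass TYPE(real ^ 'n) * integral {0<..} \<psi>"
proof -
  let ?Z = "gauss_mass TYPE(real ^ 'n)"
  let ?n = "real CARD('n)"
  have meas [measurable]: "(\<lambda>y. u y \<tau>) \<in> borel_measurable borel" for \<tau>
    by (intro borel_measurable_continuous_onI continuous_on_compose2[OF cont, of _ "\<lambda>y. (y, \<tau>)", simplified]
        continuous_intros)
  define P where "P J \<tau> \<longleftrightarrow> has_pv_integral
        (\<lambda>y. (u x t - u y \<tau>) / (t - \<tau>) powr (?n / 2 + 1 + s)
              * exp (- (norm (x - y))\<^sup>2 / (4 * (t - \<tau>)))) (J \<tau>) x" for J \<tau>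
  obtain J where pv: "AE \<tau> in lebesgue. \<tau> < t \<longrightarrow> P J \<tau>"
    and J: "J absolutely_integrable_on {..<t}" and v: "v = master_const TYPE('n) s * integral {..<t} J"
    using master unfolding has_master_def P_def by blast
  have inner: "J \<tau> = ?Z * \<psi> (t - \<tau>)"
    if \<tau>: "\<tau> < t" and pv: "P J \<tau>" for \<tau>
  proof -
    define r where "r = t - \<tau>"
    have r: "0 < r" using \<tau> by (simp add: r_def)
    let ?h = "\<lambda>y. (u x t - u y \<tau>) / r powr (?n / 2 + 1 + s)"
    let ?k = "\<lambda>y. ?h y * exp (- (norm (x - y))\<^sup>2 / (4 * r))"
    interpret prob_space "gauss :: (real ^ 'n) measure" by (rule prob_space_gauss)
    have hb: "\<bar>?h y\<bar> \<le> 2 * M / r powr (?n / 2 + 1 + s)" for y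
      using bound[of x t] bound[of y \<tau>] by (simp add: divide_right_mono)
    have hm: "?h \<in> borel_measurable borel" by measurable
    note ker = lborel_integral_heat_kernel[OF r hm hb, of x]
    have "?k absolutely_integrable_on UNIV"
      using ker(1) by (simp add: set_integrable_def integrable_completion)
    then have "J \<tau> = integral UNIV ?k"
      using pv by (intro has_pv_integral_unique) (simp_all add: r_def P_def)
    also have "\<dots> = (\<integral>y. ?k y \<partial>lborel)"
      by (rule integral_lborel) (rule ker(1))
    also have "\<dots> = r powr (?n / 2) * ?Z * (\<integral>z. ?h (x + sqrt r *\<^sub>R z) \<partial>gauss)"
      unfolding ker(2) by simp
    also have "(\<integral>z. ?h (x + sqrt r *\<^sub>R z) \<partial>gauss) = (u x t - heat u x t r) / r powr (?n / 2 + 1 + s)"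
    proof -
      have "integrable gauss (\<lambda>z. u (x + sqrt r *\<^sub>R z) \<tau>)"
        using bound by (intro integrable_gauss_bounded[where B=M]) auto
      then have "(\<integral>z. u x t - u (x + sqrt r *\<^sub>R z) \<tau> \<partial>gauss) = u x t - heat u x t r"
        using prob_space by (simp add: heat_def r_def)
      then show ?thesis by simp
    qed
    also have "r powr (?n / 2) * ?Z * ((u x t - heat u x t r) / r powr (?n / 2 + 1 + s)) =
        ?Z * ((r powr (?n / 2) / r powr (?n / 2 + 1 + s)) * (u x t - heat u x t r))"
      by simp
    also have "r powr (?n / 2) / r powr (?n / 2 + 1 + s) = r powr (- 1 - s)"
      by (simp add: powr_diff[symmetric])
    finally show ?thesis by (simp add: \<psi>_def r_def)
  qed
  \<comment> \<open>The inner identity is known only off a null set of times, which changes neither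
    integrability nor the outer integral.\<close>
  obtain N where N: "N \<in> null_sets lebesgue" and "{\<tau>. \<not> (\<tau> < t \<longrightarrow> P J \<tau>)} \<subseteq> N"
    using pv unfolding eventually_ae_filter by auto
  then have JN: "J \<tau> = ?Z * \<psi> (t - \<tau>)" if "\<tau> < t" "\<tau> \<notin> N" for \<tau>
    using that by (intro inner) auto
  have neg: "negligible N" using N by (simp add: negligible_iff_null_sets)
  have "(\<lambda>\<tau>. ?Z * \<psi> (t - \<tau>)) absolutely_integrable_on {..<t}"
    by (rule absolutely_integrable_spike[OF J neg]) (use JN in auto)
  then have ai: "(\<lambda>\<tau>. \<psi> (t - \<tau>)) absolutely_integrable_on {..<t}"
    using gauss_mass_pos[where 'a="real ^ 'n"] by (subst (asm) set_integrable_mult_right_iff) auto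
  have "integral {..<t} J = integral {..<t} (\<lambda>\<tau>. ?Z * \<psi> (t - \<tau>))"
    by (rule integral_spike[OF neg]) (use JN in auto)
  then have IJ: "integral {..<t} J = ?Z * integral {..<t} (\<lambda>\<tau>. \<psi> (t - \<tau>))"
    by simp
  have img: "(\<lambda>r. t - r) ` {0<..} = {..<t}"
  proof (intro equalityI subsetI)
    fix \<tau> assume "\<tau> \<in> {..<t}"
    then show "\<tau> \<in> (\<lambda>r. t - r) ` {0<..}" by (intro image_eqI[of _ _ "t - \<tau>"]) auto
  qed auto
  \<comment> \<open>Substitution \<open>\<tau> = t - r\<close>; the factor
    \<open>\<bar>- 1\<bar>\<close> is its Jacobian.\<close>
  have "(\<lambda>r. \<bar>- 1\<bar> * \<psi> (t - (t - r))) absolutely_integrable_on {0<..} \<and>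
      integral {0<..} (\<lambda>r. \<bar>- 1\<bar> * \<psi> (t - (t - r))) = integral {..<t} (\<lambda>\<tau>. \<psi> (t - \<tau>))"
    using ai
    by (subst has_absolute_integral_change_of_variables_1'[where g="\<lambda>r. t - r"])
      (auto simp: img inj_on_def intro!: derivative_eq_intros)
  then have "\<psi> absolutely_integrable_on {0<..}" "integral {0<..} \<psi> = integral {..<t} (\<lambda>\<tau>. \<psi> (t - \<tau>))"
    by simp_all
  then show "\<psi> integrable_on {0<..}"
    and "v = master_const TYPE('n) s * ?Z * integral {0<..} \<psi>"
    using v IJ by (auto simp: absolutely_integrable_on_def)
qed

text \<open>\<open>- s\<close> lies strictly between -1 and 0, hence is no pole of
  \<open>Gamma\<close>; at a pole \<open>Gamma\<close> would be 0 and the quotient 0.\<close>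

lemma master_const_pos:
  assumes "0 < s" "s < 1"
  shows "0 < master_const TYPE('n::finite) s"
proof -
  have "- s \<notin> \<int>\<^sub>\<le>\<^sub>0"
  proof
    assume "- s \<in> \<int>\<^sub>\<le>\<^sub>0"
    then obtain k where "- s = of_int k" by (auto elim!: nonpos_Ints_cases)
    then have "0 < - real_of_int k" "- real_of_int k < 1" using assms by auto
    then have "k < 0" "- 1 < k" by simp_all
    then show False by linarith
  qed
  then have "Gamma (- s) \<noteq> 0" by (simp add: Gamma_eq_zero_iff)
  then show ?thesis by (simp add: master_const_def)
qed

section \<open>Continuity\<close>

text \<open>The path from \<open>(x, t)\<close> to the base point goes first in time, where the
  modulus is uniform for nearby \<open>x\<close>, and then in space at the fixed time.\<close>

lemma continuous_on_of_time_modulus: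
  fixes u :: "'a::euclidean_space \<Rightarrow> real \<Rightarrow> real"
  assumes time: "\<And>x\<^sub>0 t\<^sub>0. \<exists>C. \<forall>x t. norm (x - x\<^sub>0) \<le> 1 \<longrightarrow> \<bar>t - t\<^sub>0\<bar> \<le> 1 \<longrightarrow>
      \<bar>u x t - u x t\<^sub>0\<bar> \<le> C * \<bar>t - t\<^sub>0\<bar> powr \<beta>"
    and \<beta>: "0 < \<beta>" and space: "\<And>t x\<^sub>0. isCont (\<lambda>x. u x t) x\<^sub>0"
  shows "continuous_on UNIV (\<lambda>(x, t). u x t)"
  unfolding continuous_on_eq_continuous_at[OF open_UNIV] isCont_def
proof clarify
  fix x\<^sub>0 :: 'a and t\<^sub>0 :: real
  obtain C where C: "\<And>x t. norm (x - x\<^sub>0) \<le> 1 \<Longrightarrow> \<bar>t - t\<^sub>0\<bar> \<le> 1 \<Longrightarrow>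
      \<bar>u x t - u x t\<^sub>0\<bar> \<le> C * \<bar>t - t\<^sub>0\<bar> powr \<beta>"
    using time by blast
  let ?F = "at (x\<^sub>0, t\<^sub>0)"
  have snd: "((\<lambda>p. \<bar>snd p - t\<^sub>0\<bar>) \<longlongrightarrow> 0) ?F" and fst: "((\<lambda>p. norm (fst p - x\<^sub>0)) \<longlongrightarrow> 0) ?F"
    by (auto intro!: tendsto_eq_intros)
  have 1: "((\<lambda>p. C * \<bar>snd p - t\<^sub>0\<bar> powr \<beta>) \<longlongrightarrow> C * 0) ?F"
    by (intro tendsto_mult tendsto_const tendsto_zero_powrI[OF snd]) (use \<beta> in auto)
  have 2: "((\<lambda>p. u (fst p) t\<^sub>0) \<longlongrightarrow> u x\<^sub>0 t\<^sub>0) ?F"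
    using space by (intro isCont_tendsto_compose[of x\<^sub>0 "\<lambda>x. u x t\<^sub>0"]) (auto intro!: tendsto_eq_intros)
  have lim: "((\<lambda>p. C * \<bar>snd p - t\<^sub>0\<bar> powr \<beta> + \<bar>u (fst p) t\<^sub>0 - u x\<^sub>0 t\<^sub>0\<bar>) \<longlongrightarrow> 0) ?F"
    using tendsto_add[OF 1 tendsto_rabs[OF tendsto_diff[OF 2 tendsto_const]], of "u x\<^sub>0 t\<^sub>0"] by simp
  have "\<forall>\<^sub>F p in ?F. \<bar>snd p - t\<^sub>0\<bar> < 1" "\<forall>\<^sub>F p in ?F. norm (fst p - x\<^sub>0) < 1"
    using order_tendstoD(2)[OF snd, of 1] order_tendstoD(2)[OF fst, of 1] by auto
  then have "\<forall>\<^sub>F p in ?F. norm (u (fst p) (snd p) - u x\<^sub>0 t\<^sub>0) \<le>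
      C * \<bar>snd p - t\<^sub>0\<bar> powr \<beta> + \<bar>u (fst p) t\<^sub>0 - u x\<^sub>0 t\<^sub>0\<bar>"
  proof eventually_elim
    case (elim p)
    then show ?case using C[of "fst p" "snd p"] by auto
  qed
  then have "((\<lambda>p. u (fst p) (snd p) - u x\<^sub>0 t\<^sub>0) \<longlongrightarrow> 0) ?F"
    by (rule Lim_null_comparison[OF _ lim])
  then show "(\<lambda>(x, t). u x t) \<midarrow>(x\<^sub>0, t\<^sub>0)\<rightarrow> u x\<^sub>0 t\<^sub>0"
    by (subst (asm) LIM_zero_iff) (simp add: split_def)
qed

lemma bounded_unit_box: "bounded (cball x\<^sub>0 1 \<times> cball (t\<^sub>0::real) 1)"
  by (intro bounded_Times bounded_cball)

lemma has_x_gradient_isCont: "has_x_gradient u g \<Longrightarrow> isCont (\<lambda>x. u x t) x\<^sub>0"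
  unfolding has_x_gradient_def by (meson has_derivative_continuous)

lemma parabolic_holder_loc_continuous:
  fixes u :: "real ^ 'n \<Rightarrow> real \<Rightarrow> real"
  shows "parabolic_holder_loc \<alpha> u \<Longrightarrow> continuous_on UNIV (\<lambda>(x, t). u x t)"
proof (induction rule: parabolic_holder_loc.induct)
  case (low \<alpha> u)
  show ?case
    unfolding continuous_on_eq_continuous_at[OF open_UNIV] isCont_def
  proof clarify
    fix x\<^sub>0 :: "real ^ 'n" and t\<^sub>0 :: real
    obtain C where C: "\<And>x t. (x, t) \<in> cball x\<^sub>0 1 \<times> cball t\<^sub>0 1 \<Longrightarrow>
        \<bar>u x t - u x\<^sub>0 t\<^sub>0\<bar> \<le> C * (norm (x - x\<^sub>0) + \<bar>t - t\<^sub>0\<bar> powr (1 / 2)) powr (2 * \<alpha>)"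
      using low(3)[OF bounded_unit_box[of x\<^sub>0 t\<^sub>0]]
      by (metis centre_in_cball mem_Times_iff fst_conv snd_conv zero_le_one)
    let ?F = "at (x\<^sub>0, t\<^sub>0)"
    have snd: "((\<lambda>p. \<bar>snd p - t\<^sub>0\<bar>) \<longlongrightarrow> 0) ?F" and fst: "((\<lambda>p. norm (fst p - x\<^sub>0)) \<longlongrightarrow> 0) ?F"
      by (auto intro!: tendsto_eq_intros)
    have "((\<lambda>p. \<bar>snd p - t\<^sub>0\<bar> powr (1 / 2)) \<longlongrightarrow> 0) ?F"
      by (intro tendsto_zero_powrI[OF snd]) auto
    with fst have sum: "((\<lambda>p. norm (fst p - x\<^sub>0) + \<bar>snd p - t\<^sub>0\<bar> powr (1 / 2)) \<longlongrightarrow> 0) ?F"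
      by (auto intro!: tendsto_eq_intros)
    have lim: "((\<lambda>p. C * (norm (fst p - x\<^sub>0) + \<bar>snd p - t\<^sub>0\<bar> powr (1 / 2)) powr (2 * \<alpha>)) \<longlongrightarrow> C * 0) ?F"
      using low(1) by (intro tendsto_mult tendsto_const tendsto_zero_powrI[OF sum tendsto_const]) auto
    have "\<forall>\<^sub>F p in ?F. \<bar>snd p - t\<^sub>0\<bar> < 1" "\<forall>\<^sub>F p in ?F. norm (fst p - x\<^sub>0) < 1"
      using order_tendstoD(2)[OF snd, of 1] order_tendstoD(2)[OF fst, of 1] by auto
    then have "\<forall>\<^sub>F p in ?F. norm (u (fst p) (snd p) - u x\<^sub>0 t\<^sub>0) \<le>
        C * (norm (fst p - x\<^sub>0) + \<bar>snd p - t\<^sub>0\<bar> powr (1 / 2)) powr (2 * \<alpha>)"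
    proof eventually_elim
      case (elim p)
      then have "(fst p, snd p) \<in> cball x\<^sub>0 1 \<times> cball t\<^sub>0 1"
        by (auto simp: dist_norm norm_minus_commute dist_real_def simp del: prod.collapse)
      from C[OF this] show ?case by simp
    qed
    then have "((\<lambda>p. u (fst p) (snd p) - u x\<^sub>0 t\<^sub>0) \<longlongrightarrow> 0) ?F"
      by (rule Lim_null_comparison) (use lim in simp)
    then show "(\<lambda>(x, t). u x t) \<midarrow>(x\<^sub>0, t\<^sub>0)\<rightarrow> u x\<^sub>0 t\<^sub>0"
      by (subst (asm) LIM_zero_iff) (simp add: split_def)
  qed
next
  case (mid \<alpha> u g)
  show ?case
  proof (rule continuous_on_of_time_modulus[where \<beta>=\<alpha>])
    fix x\<^sub>0 :: "real ^ 'n" and t\<^sub>0 :: real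
    obtain C where C: "\<And>x t \<tau>. (x, t) \<in> cball x\<^sub>0 1 \<times> cball t\<^sub>0 1 \<Longrightarrow> (x, \<tau>) \<in> cball x\<^sub>0 1 \<times> cball t\<^sub>0 1 \<Longrightarrow>
        \<bar>u x t - u x \<tau>\<bar> \<le> C * \<bar>t - \<tau>\<bar> powr \<alpha>"
      using mid(4)[OF bounded_unit_box[of x\<^sub>0 t\<^sub>0]] by blast
    then show "\<exists>C. \<forall>x t. norm (x - x\<^sub>0) \<le> 1 \<longrightarrow> \<bar>t - t\<^sub>0\<bar> \<le> 1 \<longrightarrow>
        \<bar>u x t - u x t\<^sub>0\<bar> \<le> C * \<bar>t - t\<^sub>0\<bar> powr \<alpha>"
      by (intro exI[of _ C]) (auto simp: dist_norm norm_minus_commute dist_real_def)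
  qed (use mid in \<open>auto intro: has_x_gradient_isCont\<close>)
next
  case (high \<alpha> u ut g H)
  show ?case
  proof (rule continuous_on_of_time_modulus[where \<beta>=1])
    fix x\<^sub>0 :: "real ^ 'n" and t\<^sub>0 :: real
    \<comment> \<open>By induction \<open>ut\<close> is continuous, hence bounded on the box, and
      \<open>u\<close> is Lipschitz in time there.\<close>
    have "compact (cball x\<^sub>0 1 \<times> cball t\<^sub>0 1)" by (intro compact_Times) auto
    then have "bounded ((\<lambda>(x, t). ut x t) ` (cball x\<^sub>0 1 \<times> cball t\<^sub>0 1))"
      by (intro compact_imp_bounded compact_continuous_image continuous_on_subset[OF high.IH(1)]) auto
    then obtain C where C: "\<And>x t. norm (x - x\<^sub>0) \<le> 1 \<Longrightarrow> \<bar>t - t\<^sub>0\<bar> \<le> 1 \<Longrightarrow> \<bar>ut x t\<bar> \<le> C"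
      unfolding bounded_iff by (force simp: dist_norm norm_minus_commute dist_real_def)
    have "\<bar>u x t - u x t\<^sub>0\<bar> \<le> C * \<bar>t - t\<^sub>0\<bar>" if "norm (x - x\<^sub>0) \<le> 1" "\<bar>t - t\<^sub>0\<bar> \<le> 1" for x t
    proof -
      have "norm (u x t - u x t\<^sub>0) \<le> C * norm (t - t\<^sub>0)"
      proof (rule field_differentiable_bound[of "cball t\<^sub>0 1"])
        fix \<tau> assume "\<tau> \<in> cball t\<^sub>0 1"
        then show "norm (ut x \<tau>) \<le> C" using C that by (simp add: dist_real_def)
        show "(u x has_field_derivative ut x \<tau>) (at \<tau> within cball t\<^sub>0 1)"
          using high.hyps(2)[of x \<tau>] by (rule has_field_derivative_at_within)
      qed (use that in \<open>auto simp: dist_real_def\<close>)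
      then show ?thesis by simp
    qed
    then show "\<exists>C. \<forall>x t. norm (x - x\<^sub>0) \<le> 1 \<longrightarrow> \<bar>t - t\<^sub>0\<bar> \<le> 1 \<longrightarrow>
        \<bar>u x t - u x t\<^sub>0\<bar> \<le> C * \<bar>t - t\<^sub>0\<bar> powr 1"
      by (intro exI[of _ C]) auto
  qed (use high in \<open>auto intro: has_x_gradient_isCont\<close>)
qed

section \<open>Moving planes\<close>

lemma integral_gauss_reflect:
  fixes f :: "'a::euclidean_space \<Rightarrow> real"
  assumes e: "e \<in> Basis" and [measurable]: "f \<in> borel_measurable borel"
  shows "(\<integral>z. f (reflect e 0 z) \<partial>gauss) = (\<integral>z. f z \<partial>gauss)"
proof -
  have w: "gauss_weight (reflect e 0 z) = gauss_weight z" for z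
    unfolding gauss_weight_def norm_reflect_square[OF e] by simp
  have "(\<integral>z. gauss_weight z * f z \<partial>lborel) =
      (\<integral>z. gauss_weight z * f z \<partial>distr lborel borel (reflect e 0))"
    by (simp only: lborel_distr_reflect[OF e])
  also have "\<dots> = (\<integral>z. gauss_weight z * f (reflect e 0 z) \<partial>lborel)"
    by (subst integral_distr) (auto simp: w)
  finally show ?thesis by (subst (1 2) integral_gauss) auto
qed

text \<open>For \<open>0 < s < 1\<close> this is the integral of
  \<open>r powr (- 1 - s) * min 1 r\<close> times \<open>1 + gauss_variance\<close>, the price of
  adding one bump.\<close>

definition bump_const :: "'a::euclidean_space itself \<Rightarrow> real \<Rightarrow> real"
  where "bump_const _ s = (1 + gauss_variance TYPE('a)) * (1 / (1 - s) + 1 / s)"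

lemma bump_const_pos: "0 < s \<Longrightarrow> s < 1 \<Longrightarrow> 0 < bump_const TYPE('a::euclidean_space) s"
  using gauss_variance_nonneg[where 'a='a] unfolding bump_const_def
  by (intro mult_pos_pos add_pos_nonneg add_pos_pos) auto

text \<open>The equation in heat form: \<open>e\<close> is the direction of the coordinate in the
  nonlinearity, and \<open>K\<close> stands for the product of \<open>master_const\<close> and
  \<open>gauss_mass\<close>.\<close>

locale indefinite_master =
  fixes u :: "'a::euclidean_space \<Rightarrow> real \<Rightarrow> real" and e :: 'a and s p M K :: real
  assumes e: "e \<in> Basis" and s: "0 < s" "s < 1" and p: "1 < p" and K: "0 < K"
    and cont: "continuous_on UNIV (\<lambda>(x, t). u x t)"
    and pos: "\<And>x t. 0 < u x t" and le_M: "\<And>x t. u x t \<le> M"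
    and int: "\<And>x t. (\<lambda>r. r powr (- 1 - s) * (u x t - heat u x t r)) integrable_on {0<..}"
    and eq: "\<And>x t. (x \<bullet> e) * u x t powr p =
      K * integral {0<..} (\<lambda>r. r powr (- 1 - s) * (u x t - heat u x t r))"
begin

lemma continuous_on_u [continuous_intros]:
  assumes "continuous_on S f" "continuous_on S g"
  shows "continuous_on S (\<lambda>y. u (f y) (g y))"
  using continuous_on_compose2[OF cont, of S "\<lambda>y. (f y, g y)"] assms
  by (auto intro: continuous_intros)

lemma u_measurable [measurable]: "(\<lambda>y. u y t) \<in> borel_measurable borel"
  by (intro borel_measurable_continuous_onI continuous_intros)

lemma M_pos: "0 < M"
  using pos le_M by (rule less_le_trans)

lemma integrable_u: "f \<in> borel_measurable borel \<Longrightarrow> integrable gauss (\<lambda>z. u (f z) t)"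
  using pos le_M by (intro integrable_gauss_bounded[where B=M]) (auto simp: abs_of_pos)

text \<open>Linearity of the operator, in a form that serves both the mirrored difference
  \<open>w l\<close> and the translated difference in \<open>u_modulus\<close>.\<close>

lemma diff_eq:
  assumes F: "F x t = u y t - u z t" and heat: "\<And>r. 0 < r \<Longrightarrow> heat F x t r = heat u y t r - heat u z t r"
  shows "(\<lambda>r. r powr (- 1 - s) * (F x t - heat F x t r)) integrable_on {0<..}"
    and "(y \<bullet> e) * u y t powr p - (z \<bullet> e) * u z t powr p =
      K * integral {0<..} (\<lambda>r. r powr (- 1 - s) * (F x t - heat F x t r))"
proof -
  let ?G = "\<lambda>y r. r powr (- 1 - s) * (u y t - heat u y t r)"
  have *: "r powr (- 1 - s) * (F x t - heat F x t r) = ?G y r - ?G z r" if "r \<in> {0<..}" for r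
    using that by (simp add: F heat algebra_simps)
  have "(\<lambda>r. ?G y r - ?G z r) integrable_on {0<..}"
    by (intro integrable_diff int)
  then show "(\<lambda>r. r powr (- 1 - s) * (F x t - heat F x t r)) integrable_on {0<..}"
    by (rule integrable_eq) (simp add: *)
  have "integral {0<..} (\<lambda>r. r powr (- 1 - s) * (F x t - heat F x t r)) = integral {0<..} (\<lambda>r. ?G y r - ?G z r)"
    using * by (rule Henstock_Kurzweil_Integration.integral_cong)
  also have "\<dots> = integral {0<..} (?G y) - integral {0<..} (?G z)"
    by (intro Henstock_Kurzweil_Integration.integral_diff int)
  finally show "(y \<bullet> e) * u y t powr p - (z \<bullet> e) * u z t powr p =
      K * integral {0<..} (\<lambda>r. r powr (- 1 - s) * (F x t - heat F x t r))"
    by (simp add: eq right_diff_distrib)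
qed

section \<open>Estimates for the difference across the mirror\<close>

definition w :: "real \<Rightarrow> 'a \<Rightarrow> real \<Rightarrow> real"
  where "w l x t = u (reflect e l x) t - u x t"

lemma w_reflect: "w l (reflect e l x) t = - w l x t"
  using e by (simp add: w_def)

lemma w_abs_le: "\<bar>w l x t\<bar> \<le> M"
  using pos[of x t] le_M[of x t] pos[of "reflect e l x" t] le_M[of "reflect e l x" t]
  by (simp add: w_def)

lemma w_measurable [measurable]: "(\<lambda>y. w l y t) \<in> borel_measurable borel"
  unfolding w_def by measurable

text \<open>Mirroring \<open>x + sqrt r *\<^sub>R z\<close> mirrors the base point and applies
  \<open>reflect e 0\<close> to \<open>z\<close>, which preserves the Gaussian.\<close>

lemma heat_w: "heat (w l) x t r = heat u (reflect e l x) t r - heat u x t r"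
proof -
  have 1: "reflect e l (x + sqrt r *\<^sub>R z) = reflect e l x + sqrt r *\<^sub>R reflect e 0 z" for z
    by (simp add: reflect_def inner_add_left algebra_simps)
  have "heat (w l) x t r = (\<integral>z. u (reflect e l (x + sqrt r *\<^sub>R z)) (t - r) \<partial>gauss) - heat u x t r"
    unfolding heat_def w_def by (intro Bochner_Integration.integral_diff integrable_u) auto
  also have "(\<integral>z. u (reflect e l (x + sqrt r *\<^sub>R z)) (t - r) \<partial>gauss) = heat u (reflect e l x) t r"
    unfolding 1 heat_def
    by (rule integral_gauss_reflect[OF e, of "\<lambda>z. u (reflect e l x + sqrt r *\<^sub>R z) (t - r)"]) auto
  finally show ?thesis .
qed

lemma w_eq:
  shows "(\<lambda>r. r powr (- 1 - s) * (w l x t - heat (w l) x t r)) integrable_on {0<..}"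
    and "(2 * l - x \<bullet> e) * u (reflect e l x) t powr p - (x \<bullet> e) * u x t powr p =
      K * integral {0<..} (\<lambda>r. r powr (- 1 - s) * (w l x t - heat (w l) x t r))"
  using diff_eq[of "w l" x t "reflect e l x" x] e heat_w by (simp_all add: w_def)

text \<open>Any threshold above 1 would do: the half-space must lie beyond the rescaled mirror,
  whose position is at most 1 once \<open>r\<close> is at least the squared distance to it.\<close>

abbreviation q :: real
  where "q \<equiv> measure gauss {z. 2 \<le> z \<bullet> e}"

lemma reflect_affine:
  assumes "0 < r"
  shows "reflect e l (x + sqrt r *\<^sub>R z) = x + sqrt r *\<^sub>R reflect e ((l - x \<bullet> e) / sqrt r) z"
proof -
  have "sqrt r * (2 * ((l - x \<bullet> e) / sqrt r - z \<bullet> e)) = 2 * (l - (x + sqrt r *\<^sub>R z) \<bullet> e)"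
    using assms by (simp add: inner_add_left field_simps)
  then show ?thesis unfolding reflect_def scaleR_add_right scaleR_scaleR by (simp add: add.assoc)
qed

text \<open>The lower bound on the near side is extended antisymmetrically across the mirror and
  subtracted from \<open>w l\<close>; the difference has nonnegative Gaussian mean. Mass beyond the
  mirror counts with the opposite sign, which improves the factor 1 to \<open>1 - 2 * q\<close> at
  large scales.\<close>

lemma heat_w_lower_bound:
  assumes x: "x \<bullet> e < l" and r: "0 < r" and "0 \<le> m" "0 \<le> \<epsilon>"
    and lower: "\<And>y. y \<bullet> e \<le> l \<Longrightarrow> - m - \<epsilon> * bump x\<^sub>0 t\<^sub>0 y (t - r) \<le> w l y (t - r)"
  shows "- m * (1 - (if (l - x \<bullet> e)\<^sup>2 \<le> r then 2 * q else 0)) - \<epsilon> * heat (bump x\<^sub>0 t\<^sub>0) x t r \<le>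
    heat (w l) x t r"
proof -
  interpret prob_space "gauss :: 'a measure" by (rule prob_space_gauss)
  define c where "c = (l - x \<bullet> e) / sqrt r"
  have c: "0 < c" using x r by (simp add: c_def)
  let ?T = "\<lambda>z. x + sqrt r *\<^sub>R z"
  let ?b = "\<lambda>z. bump x\<^sub>0 t\<^sub>0 (?T z) (t - r)"
  \<comment> \<open>\<open>\<sigma>\<close> is the odd extension of 1 across the rescaled mirror and
    \<open>b'\<close> the even extension of the bump, so \<open>b' * \<sigma>\<close> is
    odd.\<close>
  define \<sigma> :: "'a \<Rightarrow> real" where "\<sigma> z = (if z \<bullet> e < c then 1 else if c < z \<bullet> e then - 1 else 0)" for z
  define b' where "b' z = (if z \<bullet> e < c then ?b z else ?b (reflect e c z))" for z
  define W where "W z = w l (?T z) (t - r)" for z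
  have [measurable]: "\<sigma> \<in> borel_measurable borel" "b' \<in> borel_measurable borel" "W \<in> borel_measurable borel"
    unfolding \<sigma>_def b'_def W_def by measurable
  have \<sigma>: "\<bar>\<sigma> z\<bar> \<le> 1" and b': "0 \<le> b' z" "b' z \<le> 1" and W: "\<bar>W z\<bar> \<le> M" for z
    by (auto simp: \<sigma>_def b'_def W_def bump_nonneg bump_le_1 w_abs_le)
  have \<sigma>b': "\<bar>b' z * \<sigma> z\<bar> \<le> 1" for z
    using mult_mono[OF b'(2) \<sigma>, of z] b'(1)[of z] by (simp add: abs_mult)
  have i\<sigma>: "integrable gauss \<sigma>"
    by (rule integrable_gauss_bounded[OF _ \<sigma>]) measurable
  have iW: "integrable gauss W"
    by (rule integrable_gauss_bounded[OF _ W]) measurable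
  have ib\<sigma>: "integrable gauss (\<lambda>z. b' z * \<sigma> z)"
    by (rule integrable_gauss_bounded[OF _ \<sigma>b']) measurable
  have ib: "integrable gauss ?b"
    by (rule integrable_gauss_bounded[where B=1]) (auto simp: bump_nonneg bump_le_1)
  have "0 \<le> (\<integral>z. W z + m * \<sigma> z + \<epsilon> * (b' z * \<sigma> z) \<partial>gauss)"
  proof (rule integral_gauss_antisymmetric_nonneg[OF e less_imp_le[OF c]])
    show "(\<lambda>z. W z + m * \<sigma> z + \<epsilon> * (b' z * \<sigma> z)) \<in> borel_measurable borel" by measurable
    fix z
    show "\<bar>W z + m * \<sigma> z + \<epsilon> * (b' z * \<sigma> z)\<bar> \<le> M + m + \<epsilon>"
      using W[of z] mult_left_mono[OF \<sigma>[of z] \<open>0 \<le> m\<close>] mult_left_mono[OF \<sigma>b'[of z] \<open>0 \<le> \<epsilon>\<close>] assms(3,4)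
      by (auto simp: abs_mult intro!: order_trans[OF abs_triangle_ineq] add_mono)
    have "W (reflect e c z) = - W z"
      unfolding W_def c_def reflect_affine[OF r, symmetric] by (rule w_reflect)
    moreover have "\<sigma> (reflect e c z) = - \<sigma> z" using e by (auto simp: \<sigma>_def)
    moreover have "b' (reflect e c z) * \<sigma> z = b' z * \<sigma> z" using e by (auto simp: \<sigma>_def b'_def)
    ultimately show "W (reflect e c z) + m * \<sigma> (reflect e c z) + \<epsilon> * (b' (reflect e c z) * \<sigma> (reflect e c z)) =
        - (W z + m * \<sigma> z + \<epsilon> * (b' z * \<sigma> z))"
      by simp
  next
    fix z assume z: "z \<bullet> e < c"
    then have "?T z \<bullet> e \<le> l" using r e by (simp add: c_def inner_add_left field_simps)
    then show "0 \<le> W z + m * \<sigma> z + \<epsilon> * (b' z * \<sigma> z)"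
      using lower[of "?T z"] z by (simp add: W_def \<sigma>_def b'_def)
  qed
  also have "\<dots> = (\<integral>z. W z \<partial>gauss) + m * (\<integral>z. \<sigma> z \<partial>gauss) + \<epsilon> * (\<integral>z. b' z * \<sigma> z \<partial>gauss)"
    using i\<sigma> iW ib\<sigma> by simp
  finally have main: "- m * (\<integral>z. \<sigma> z \<partial>gauss) - \<epsilon> * (\<integral>z. b' z * \<sigma> z \<partial>gauss) \<le> heat (w l) x t r"
    by (simp add: heat_def W_def)
  \<comment> \<open>On the near side \<open>b' * \<sigma>\<close> is the bump itself; beyond the
    mirror it is at most 0.\<close>
  have "(\<integral>z. b' z * \<sigma> z \<partial>gauss) \<le> (\<integral>z. ?b z \<partial>gauss)"
    by (rule integral_mono[OF ib\<sigma> ib]) (auto simp: b'_def \<sigma>_def bump_nonneg intro: order_trans[OF _ bump_nonneg])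
  then have 1: "\<epsilon> * (\<integral>z. b' z * \<sigma> z \<partial>gauss) \<le> \<epsilon> * heat (bump x\<^sub>0 t\<^sub>0) x t r"
    unfolding heat_def using \<open>0 \<le> \<epsilon>\<close> by (rule mult_left_mono)
  have "(\<integral>z. \<sigma> z \<partial>gauss) \<le> 1 - (if (l - x \<bullet> e)\<^sup>2 \<le> r then 2 * q else 0)"
  proof (cases "(l - x \<bullet> e)\<^sup>2 \<le> r")
    case True
    then have "c \<le> 1" using x r real_le_rsqrt[of "l - x \<bullet> e" r] by (simp add: c_def)
    have ind: "integrable gauss (indicator {z. 2 \<le> z \<bullet> e} :: 'a \<Rightarrow> real)"
      by (rule integrable_gauss_bounded[where B=1]) (auto simp: indicator_def)
    have ii: "integrable gauss (\<lambda>z::'a. 1 - 2 * indicator {z. 2 \<le> z \<bullet> e} z :: real)"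
      using ind by (intro Bochner_Integration.integrable_diff) auto
    have "(\<integral>z. \<sigma> z \<partial>gauss) \<le> (\<integral>z. 1 - 2 * indicator {z. 2 \<le> z \<bullet> e} z \<partial>gauss)"
      using \<open>c \<le> 1\<close> by (intro integral_mono[OF i\<sigma> ii]) (auto simp: \<sigma>_def indicator_def)
    also have "\<dots> = (\<integral>z. 1 \<partial>(gauss :: 'a measure)) - (\<integral>z. 2 * indicator {z. 2 \<le> z \<bullet> e} z \<partial>gauss)"
      by (intro Bochner_Integration.integral_diff) (auto intro: ind)
    also have "\<dots> = 1 - 2 * q" using prob_space by simp
    finally show ?thesis using True by simp
  next
    case False
    have "(\<integral>z. \<sigma> z \<partial>gauss) \<le> (\<integral>z. 1 \<partial>(gauss :: 'a measure))"
      by (intro integral_mono[OF i\<sigma>]) (auto simp: \<sigma>_def)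
    then show ?thesis using False prob_space by simp
  qed
  then have 2: "m * (\<integral>z. \<sigma> z \<partial>gauss) \<le> m * (1 - (if (l - x \<bullet> e)\<^sup>2 \<le> r then 2 * q else 0))"
    using \<open>0 \<le> m\<close> by (rule mult_left_mono)
  show ?thesis using main 1 2 by linarith
qed

text \<open>At a minimum of \<open>w l\<close> plus the bump, the bump costs at most
  \<open>\<epsilon> * bump_const\<close>, while antisymmetry gains \<open>2 * q\<close> times the
  depth at all scales above the squared distance to the mirror. Integrating the weight over those
  scales gives the power \<open>- 2 * s\<close> of the distance.\<close>

lemma estimate_at_near_minimum:
  assumes lower: "\<And>x t. x \<bullet> e < l \<Longrightarrow> - m \<le> w l x t"
    and x\<^sub>0: "x\<^sub>0 \<bullet> e < l" and near: "w l x\<^sub>0 t\<^sub>0 \<le> - m + \<epsilon>" and \<epsilon>: "0 < \<epsilon>" "\<epsilon> < m"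
  obtains x t where "x \<bullet> e < l" and "w l x t \<le> - (m - \<epsilon>)"
    and "(2 * l - x \<bullet> e) * u (reflect e l x) t powr p - (x \<bullet> e) * u x t powr p \<le>
      K * (\<epsilon> * bump_const TYPE('a) s - 2 * q * (m - \<epsilon>) * ((l - x \<bullet> e) powr (- 2 * s) / s))"
proof -
  let ?S = "{x. x \<bullet> e \<le> l}"
  \<comment> \<open>Since \<open>w l\<close> vanishes on the mirror, the closed half-space can be
    used for compactness, and a minimum with negative \<open>w l\<close> still lies strictly
    inside.\<close>
  have plane: "w l x t = 0" if "x \<bullet> e = l" for x t
    using that by (simp add: w_def reflect_def)
  have "continuous_on UNIV (\<lambda>(x, t). w l x t)"
    unfolding w_def split_def reflect_def by (intro continuous_intros)
  moreover have "closed ?S" by (rule closed_halfspace_component_le)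
  moreover have "w l x\<^sub>0 t\<^sub>0 - \<epsilon> \<le> w l x t" if "x \<in> ?S" for x t
    using that lower[of x t] plane[of x t] near \<epsilon> by (cases "x \<bullet> e = l") auto
  ultimately obtain x t where x: "x \<in> ?S"
    and min: "\<And>y \<tau>. y \<in> ?S \<Longrightarrow> w l x t + \<epsilon> * bump x\<^sub>0 t\<^sub>0 x t \<le> w l y \<tau> + \<epsilon> * bump x\<^sub>0 t\<^sub>0 y \<tau>"
    using attains_min_plus_bump[of "w l" ?S x\<^sub>0 \<epsilon> t\<^sub>0] x\<^sub>0 \<epsilon> by (metis less_imp_le mem_Collect_eq)
  \<comment> \<open>With the exact penalised minimum in place of \<open>m\<close>, the term
    \<open>\<epsilon> * bump\<close> at \<open>(x, t)\<close> cancels below and only its increase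
    under the heat average remains.\<close>
  define m' where "m' = - (w l x t + \<epsilon> * bump x\<^sub>0 t\<^sub>0 x t)"
  have m': "m - \<epsilon> \<le> m'" using min[of x\<^sub>0 t\<^sub>0] x\<^sub>0 near by (simp add: m'_def)
  have wx: "w l x t = - m' - \<epsilon> * bump x\<^sub>0 t\<^sub>0 x t" by (simp add: m'_def)
  have "0 \<le> \<epsilon> * bump x\<^sub>0 t\<^sub>0 x t" using \<epsilon> by (simp add: bump_nonneg)
  then have wle: "w l x t \<le> - (m - \<epsilon>)" using wx m' by simp
  then have xl: "x \<bullet> e < l" using x plane[of x t] \<epsilon> by (cases "x \<bullet> e = l") auto
  define d where "d = l - x \<bullet> e"
  have d: "0 < d" using xl by (simp add: d_def)
  let ?V = "gauss_variance TYPE('a)"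
  have \<psi>: "w l x t - heat (w l) x t r \<le> \<epsilon> * (1 + ?V) * min 1 r - (if d\<^sup>2 \<le> r then 2 * q * m' else 0)"
    if r: "0 < r" for r
  proof -
    have "- m' * (1 - (if d\<^sup>2 \<le> r then 2 * q else 0)) - \<epsilon> * heat (bump x\<^sub>0 t\<^sub>0) x t r \<le> heat (w l) x t r"
      unfolding d_def
    proof (rule heat_w_lower_bound[OF xl r])
      show "- m' - \<epsilon> * bump x\<^sub>0 t\<^sub>0 y (t - r) \<le> w l y (t - r)" if "y \<bullet> e \<le> l" for y
        using min[of y "t - r"] that by (simp add: m'_def)
    qed (use m' \<epsilon> in auto)
    moreover have "\<epsilon> * heat (bump x\<^sub>0 t\<^sub>0) x t r \<le> \<epsilon> * (bump x\<^sub>0 t\<^sub>0 x t + (1 + ?V) * min 1 r)"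
      using heat_bump_le[OF r] \<epsilon> by (intro mult_left_mono) auto
    ultimately show ?thesis unfolding wx by (auto simp: algebra_simps)
  qed
  have "integral {0<..} (\<lambda>r. r powr (- 1 - s) * (w l x t - heat (w l) x t r)) \<le>
      \<epsilon> * (1 + ?V) * (1 / (1 - s) + 1 / s) - 2 * q * m' * ((d\<^sup>2) powr (- s) / s)"
  proof (rule integral_powr_le[where \<psi>="\<lambda>r. w l x t - heat (w l) x t r", OF s])
    show "0 < d\<^sup>2" using d by simp
  qed (use w_eq(1) \<psi> in blast)+
  also have "(d\<^sup>2) powr (- s) = d powr (- 2 * s)"
    using d powr_powr[of d 2 "- s"] by simp
  finally have "integral {0<..} (\<lambda>r. r powr (- 1 - s) * (w l x t - heat (w l) x t r)) \<le>
      \<epsilon> * bump_const TYPE('a) s - 2 * q * m' * (d powr (- 2 * s) / s)"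
    by (simp add: bump_const_def mult.assoc)
  moreover have "2 * q * (m - \<epsilon>) * (d powr (- 2 * s) / s) \<le> 2 * q * m' * (d powr (- 2 * s) / s)"
    using m' s by (intro mult_right_mono mult_left_mono) auto
  ultimately have "integral {0<..} (\<lambda>r. r powr (- 1 - s) * (w l x t - heat (w l) x t r)) \<le>
      \<epsilon> * bump_const TYPE('a) s - 2 * q * (m - \<epsilon>) * (d powr (- 2 * s) / s)"
    by linarith
  then show thesis
    using that[OF xl wle] K unfolding w_eq(2) d_def by simp
qed

lemma w_pos:
  assumes nonneg: "\<And>x t. x \<bullet> e < l \<Longrightarrow> 0 \<le> w l x t" and x: "x \<bullet> e < l"
  shows "0 < w l x t"
proof (rule ccontr)
  assume "\<not> 0 < w l x t"
  with nonneg[OF x] have w0: "w l x t = 0" by (metis less_eq_real_def)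
  have nn: "0 \<le> w l y \<tau>" if "y \<bullet> e \<le> l" for y \<tau>
    using nonneg[of y \<tau>] that by (cases "y \<bullet> e = l") (auto simp: w_def reflect_def)
  \<comment> \<open>With \<open>m\<close> and \<open>\<epsilon>\<close> equal to 0 the lower bound
    says that the heat average is nonnegative; the threshold 1 is a dummy.\<close>
  have "w l x t - heat (w l) x t r \<le> 0 * min 1 r - (if 1 \<le> r then 0 else 0)" if "0 < r" for r
    using heat_w_lower_bound[OF x that, of 0 0] nn w0 by simp
  then have "integral {0<..} (\<lambda>r. r powr (- 1 - s) * (w l x t - heat (w l) x t r)) \<le>
      0 * (1 / (1 - s) + 1 / s) - 0 * (1 powr (- s) / s)"
    by (intro integral_powr_le[where \<psi>="\<lambda>r. w l x t - heat (w l) x t r", OF s zero_less_one w_eq(1)])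
  then have "(2 * l - x \<bullet> e) * u (reflect e l x) t powr p - (x \<bullet> e) * u x t powr p \<le> 0"
    using K unfolding w_eq(2) by (simp add: mult_le_0_iff)
  moreover have "u (reflect e l x) t = u x t" using w0 by (simp add: w_def)
  ultimately have "2 * (l - x \<bullet> e) * u x t powr p \<le> 0" by (simp add: algebra_simps)
  then show False using x pos[of x t] by (simp add: mult_le_0_iff)
qed

end

section \<open>A negative infimum of \<open>w\<close> is bounded away from zero\<close>

lemma powr_diff_bounds:
  fixes a b p :: real
  assumes "0 < b" "b \<le> a" "1 < p"
  shows "a powr p - b powr p \<le> p * a powr (p - 1) * (a - b)"
    and "a powr (p - 1) * (a - b) \<le> a powr p - b powr p"
proof -
  have a: "0 < a" using assms by simp
  show "a powr p - b powr p \<le> p * a powr (p - 1) * (a - b)"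
  proof (cases "b = a")
    case False
    then have "b < a" using assms by simp
    have "\<exists>z. b < z \<and> z < a \<and> a powr p - b powr p = (a - b) * (p * z powr (p - 1))"
      by (rule MVT2[OF \<open>b < a\<close>]) (use assms in \<open>auto intro!: derivative_eq_intros\<close>)
    then obtain z where z: "b < z" "z < a" "a powr p - b powr p = (a - b) * (p * z powr (p - 1))"
      by blast
    have "z powr (p - 1) \<le> a powr (p - 1)" using z assms by (intro powr_mono2) auto
    then have "(a - b) * (p * z powr (p - 1)) \<le> (a - b) * (p * a powr (p - 1))"
      using assms by (intro mult_left_mono) auto
    then show ?thesis unfolding z(3) by (simp add: mult_ac)
  qed simp
  have "b * b powr (p - 1) \<le> b * a powr (p - 1)"
    using assms by (intro mult_left_mono powr_mono2) auto
  then have "b powr p \<le> a powr (p - 1) * b"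
    using powr_mult_base[of b "p - 1"] assms by (simp add: mult.commute)
  moreover have "a powr p = a powr (p - 1) * a"
    using powr_mult_base[of a "p - 1"] a by (simp add: mult.commute)
  ultimately show "a powr (p - 1) * (a - b) \<le> a powr p - b powr p" by (simp add: algebra_simps)
qed

context indefinite_master
begin

lemma q_pos: "0 < q"
  by (rule gauss_halfspace_pos[OF e])

text \<open>With \<open>m = - inf w\<close>, near a minimum the equation reads
  \<open>2 d u\<^sub>l\<^sup>p - x\<^sub>1 (u\<^sup>p - u\<^sub>l\<^sup>p) \<le> o(1) - c m d\<^sup>-\<^sup>2\<^sup>s\<close> with \<open>d = l - x\<^sub>1\<close>. It excludes
  \<open>x\<^sub>1 \<le> 0\<close>, and for \<open>0 < x\<^sub>1\<close> it bounds \<open>u\<close> and \<open>d\<close> from below, which in turn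
  bounds \<open>m\<close> from below.\<close>

lemma w_nonneg_if_almost:
  fixes \<Lambda> :: real
  assumes \<Lambda>: "0 < \<Lambda>"
  obtains \<delta> where "0 < \<delta>"
    and "\<And>l x t. l \<le> \<Lambda> \<Longrightarrow> (\<And>x t. 0 < x \<bullet> e \<Longrightarrow> x \<bullet> e < l \<Longrightarrow> - \<delta> \<le> w l x t) \<Longrightarrow>
      x \<bullet> e < l \<Longrightarrow> 0 \<le> w l x t"
proof -
  \<comment> \<open>\<open>L\<close> bounds \<open>d\<close> whenever \<open>- 1 < X\<close>.
    \<open>\<kappa>\<close> is a quarter of the gain coefficient: one half goes into replacing
    \<open>m - \<epsilon>\<close> by \<open>m / 2\<close>, and half of the rest absorbs the
    bump.\<close>
  define L where "L = \<Lambda> + 1"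
  define \<kappa> where "\<kappa> = K * (2 * q / s) / 4"
  define A where "A = K * bump_const TYPE('a) s"
  \<comment> \<open>\<open>a\<close> and \<open>d\<^sub>0\<close> are the lower bounds for
    \<open>U\<close> and \<open>d\<close> obtained by solving
    \<open>\<kappa> * L powr (- 2 * s) \<le> L * p * U powr (p - 1)\<close> and
    \<open>\<kappa> * d powr (- 2 * s) \<le> D\<close>.\<close>
  define a where "a = (\<kappa> * L powr (- 2 * s) / (L * p)) powr (1 / (p - 1))"
  define D where "D = L * p * M powr (p - 1)"
  define d\<^sub>0 where "d\<^sub>0 = (D / \<kappa>) powr (- 1 / (2 * s))"
  \<comment> \<open>The first entry keeps \<open>V\<close> above \<open>a / 2\<close>; the second
    makes \<open>2 * \<delta> * D\<close> at most half of
    \<open>2 * d\<^sub>0 * (a / 2) powr p\<close>.\<close>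
  define \<delta> where "\<delta> = min (a / 4) (d\<^sub>0 * (a / 2) powr p / (2 * D))"
  have L: "0 < L" using \<Lambda> by (simp add: L_def)
  have \<kappa>: "0 < \<kappa>" using K q_pos s by (simp add: \<kappa>_def)
  have A: "0 < A" using K bump_const_pos[OF s, where 'a='a] by (simp add: A_def)
  have a: "0 < a" using \<kappa> L p by (simp add: a_def)
  have D: "0 < D" using L p M_pos by (simp add: D_def)
  have d\<^sub>0: "0 < d\<^sub>0" using D \<kappa> by (simp add: d\<^sub>0_def)
  have \<delta>: "0 < \<delta>" using a d\<^sub>0 D by (simp add: \<delta>_def)
  have "0 \<le> w l x\<^sub>1 t\<^sub>1"
    if l: "l \<le> \<Lambda>" and almost: "\<And>x t. 0 < x \<bullet> e \<Longrightarrow> x \<bullet> e < l \<Longrightarrow> - \<delta> \<le> w l x t"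
      and x\<^sub>1: "x\<^sub>1 \<bullet> e < l" for l x\<^sub>1 t\<^sub>1
  proof (rule ccontr)
    assume neg: "\<not> 0 \<le> w l x\<^sub>1 t\<^sub>1"
    define N where "N = {- w l x t | x t. x \<bullet> e < l}"
    define m where "m = Sup N"
    have N: "bdd_above N" "- w l x\<^sub>1 t\<^sub>1 \<in> N"
      using w_abs_le x\<^sub>1 by (auto simp: N_def bdd_above_def abs_le_iff)
    have lower: "- m \<le> w l x t" if "x \<bullet> e < l" for x t
    proof -
      have "- w l x t \<in> N" using that by (auto simp: N_def)
      then show ?thesis using cSup_upper[OF _ N(1)] by (fastforce simp: m_def)
    qed
    then have m: "0 < m" using neg lower[OF x\<^sub>1, of t\<^sub>1] by linarith
    \<comment> \<open>The second entry lets the gain absorb the bump when \<open>- 1 < X\<close>,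
      the third lets the nonlinear term absorb it when \<open>X \<le> - 1\<close>.\<close>
    define \<epsilon> where "\<epsilon> = min (m / 4) (min (\<kappa> * m * L powr (- 2 * s) / A) ((m / 2) powr p / (2 * A)))"
    have "0 < \<epsilon>" using m \<kappa> L A by (simp add: \<epsilon>_def)
    moreover have "\<epsilon> \<le> m / 4" unfolding \<epsilon>_def by (rule min.cobounded1)
    ultimately have \<epsilon>: "0 < \<epsilon>" "\<epsilon> \<le> m / 4" .
    have "\<epsilon> \<le> \<kappa> * m * L powr (- 2 * s) / A" "\<epsilon> \<le> (m / 2) powr p / (2 * A)"
      by (simp_all add: \<epsilon>_def)
    then have A\<epsilon>: "A * \<epsilon> \<le> \<kappa> * m * L powr (- 2 * s)" "A * \<epsilon> \<le> (m / 2) powr p / 2"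
      using A by (simp_all add: field_simps)
    have "m - \<epsilon> < Sup N" using \<epsilon> by (simp add: m_def)
    then obtain y where "y \<in> N" and y: "m - \<epsilon> < y"
      using less_cSup_iff[of N "m - \<epsilon>"] N by auto
    then obtain x\<^sub>0 t\<^sub>0 where "x\<^sub>0 \<bullet> e < l" "y = - w l x\<^sub>0 t\<^sub>0"
      by (auto simp: N_def)
    with y have x\<^sub>0: "x\<^sub>0 \<bullet> e < l" "w l x\<^sub>0 t\<^sub>0 \<le> - m + \<epsilon>" by simp_all
    obtain x t where x: "x \<bullet> e < l" and wx: "w l x t \<le> - (m - \<epsilon>)"
      and est: "(2 * l - x \<bullet> e) * u (reflect e l x) t powr p - (x \<bullet> e) * u x t powr p \<le>
        K * (\<epsilon> * bump_const TYPE('a) s - 2 * q * (m - \<epsilon>) * ((l - x \<bullet> e) powr (- 2 * s) / s))"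
    proof (rule estimate_at_near_minimum[OF lower x\<^sub>0 \<epsilon>(1)])
      show "\<epsilon> < m" using \<epsilon> m by simp
    qed
    define X d U V where "X = x \<bullet> e" "d = l - x \<bullet> e" "U = u x t" "V = u (reflect e l x) t"
    note defs = X_d_U_V_def
    have d: "0 < d" using x by (simp add: defs)
    have UV: "0 < V" "0 < U" "U \<le> M" "V \<le> U - m / 2" "U - m \<le> V"
      using pos le_M wx \<epsilon> m lower[OF x, of t] by (auto simp: defs w_def)
    have "V \<le> U" using UV m by simp
    note powr_diff = powr_diff_bounds[OF UV(1) \<open>V \<le> U\<close> p]
    have "4 * \<kappa> * (m / 2) * d powr (- 2 * s) \<le> 4 * \<kappa> * (m - \<epsilon>) * d powr (- 2 * s)"
      using \<kappa> \<epsilon> m by (intro mult_right_mono mult_left_mono) auto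
    moreover have "(2 * l - X) * V powr p - X * U powr p = 2 * d * V powr p - X * (U powr p - V powr p)"
      by (simp add: defs algebra_simps)
    moreover have "K * (\<epsilon> * bump_const TYPE('a) s - 2 * q * k * (D' / s)) = A * \<epsilon> - 4 * \<kappa> * k * D'" for k D'
      by (simp add: A_def \<kappa>_def algebra_simps)
    ultimately have main: "2 * d * V powr p - X * (U powr p - V powr p) \<le>
        A * \<epsilon> - 2 * \<kappa> * m * d powr (- 2 * s)"
      using est unfolding defs by (simp add: mult.assoc)
    have nn: "0 \<le> 2 * d * V powr p" "0 < \<kappa> * m * d powr (- 2 * s)"
      using d \<kappa> m by simp_all
    have UVp: "(m / 2) powr p \<le> U powr p - V powr p"
    proof -
      have "(m / 2) powr p = (m / 2) powr (p - 1) * (m / 2)"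
        using powr_mult_base[of "m / 2" "p - 1"] m by (simp add: mult.commute)
      also have "\<dots> \<le> U powr (p - 1) * (U - V)"
        using UV m p by (intro mult_mono powr_mono2) auto
      also note powr_diff(2)
      finally show ?thesis .
    qed
    have mp: "0 < (m / 2) powr p" using m by simp
    then have UVp0: "0 \<le> U powr p - V powr p" using UVp by linarith
    \<comment> \<open>Far to the left \<open>d\<close> is unbounded and the gain may vanish, but
      there the term with \<open>- X\<close> is at least \<open>(m / 2) powr p\<close>. For
      \<open>- 1 < X \<le> 0\<close> the gain is bounded below because
      \<open>d \<le> L\<close>.\<close>
    consider "X \<le> - 1" | "- 1 < X" "X \<le> 0" | "0 < X" by linarith
    then show False
    proof cases
      case 1
      then have "1 * (m / 2) powr p \<le> (- X) * (U powr p - V powr p)"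
        using UVp mp by (intro mult_mono) auto
      then show False using main nn A\<epsilon>(2) mp by simp
    next
      case 2
      then have "d \<le> L" using l by (simp add: defs L_def)
      then have "L powr (- 2 * s) \<le> d powr (- 2 * s)" using d s by (intro powr_mono2') auto
      then have "\<kappa> * m * L powr (- 2 * s) \<le> \<kappa> * m * d powr (- 2 * s)"
        using \<kappa> m by (intro mult_left_mono) auto
      moreover have "0 \<le> (- X) * (U powr p - V powr p)"
        using 2 UVp0 by (intro mult_nonneg_nonneg) auto
      ultimately show False using main nn A\<epsilon>(1) by simp
    next
      case 3
      have dL: "d \<le> L" and XL: "X \<le> L" using l 3 d by (auto simp: defs L_def)
      \<comment> \<open>The minimum point lies in the strip, where \<open>w\<close> is at least
        \<open>- \<delta>\<close> by assumption.\<close>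
      have m\<delta>: "m \<le> 2 * \<delta>" using almost[of x t] 3 x wx \<epsilon> by (simp add: defs)
      have L_d: "L powr (- 2 * s) \<le> d powr (- 2 * s)" using d dL s by (intro powr_mono2') auto
      then have "\<kappa> * m * L powr (- 2 * s) \<le> \<kappa> * m * d powr (- 2 * s)"
        using \<kappa> m by (intro mult_left_mono) auto
      then have "2 * d * V powr p + \<kappa> * m * d powr (- 2 * s) \<le> X * (U powr p - V powr p)"
        using main A\<epsilon>(1) by simp
      also have "\<dots> \<le> L * (p * U powr (p - 1) * m)"
      proof (intro mult_mono XL order_trans[OF powr_diff(1)] mult_left_mono)
        show "0 \<le> U powr p - V powr p" by (rule UVp0)
      qed (use UV p L in auto)
      \<comment> \<open>Discarding the first term on the left bounds \<open>U\<close> and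
        \<open>d\<close> from below; discarding the second then bounds \<open>m\<close> from
        below.\<close>
      finally have bal: "2 * d * V powr p + m * (\<kappa> * d powr (- 2 * s)) \<le> m * (L * p * U powr (p - 1))"
        by (simp add: mult_ac)
      then have "m * (\<kappa> * d powr (- 2 * s)) \<le> m * (L * p * U powr (p - 1))" using nn by linarith
      then have \<kappa>d: "\<kappa> * d powr (- 2 * s) \<le> L * p * U powr (p - 1)" using m by simp
      have UM: "L * p * U powr (p - 1) \<le> D"
        unfolding D_def using UV p L by (intro mult_left_mono powr_mono2) auto
      have "\<kappa> * L powr (- 2 * s) \<le> L * p * U powr (p - 1)"
        using \<kappa>d mult_left_mono[OF L_d less_imp_le[OF \<kappa>]] by simp
      then have "\<kappa> * L powr (- 2 * s) / (L * p) \<le> U powr (p - 1)"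
        using L p by (simp add: field_simps)
      then have "a \<le> (U powr (p - 1)) powr (1 / (p - 1))"
        unfolding a_def using \<kappa> L p by (intro powr_mono2) auto
      then have "a \<le> U" using UV p by (simp add: powr_powr)
      moreover have "\<delta> \<le> a / 4" by (simp add: \<delta>_def)
      ultimately have aV: "a / 2 \<le> V" using UV m\<delta> by simp
      have "d powr (- 2 * s) \<le> D / \<kappa>" using \<kappa>d UM \<kappa> by (simp add: field_simps)
      then have "(D / \<kappa>) powr (- 1 / (2 * s)) \<le> (d powr (- 2 * s)) powr (- 1 / (2 * s))"
        using d s by (intro powr_mono2') auto
      then have "d\<^sub>0 \<le> d" using d s by (simp add: powr_powr d\<^sub>0_def)
      then have "2 * d\<^sub>0 * (a / 2) powr p \<le> 2 * d * V powr p"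
        using aV a d\<^sub>0 p by (intro mult_mono powr_mono2) auto
      also have "\<dots> \<le> m * D"
        using bal nn mult_left_mono[OF UM less_imp_le[OF m]] by (simp add: mult_ac)
      also have "\<dots> \<le> 2 * \<delta> * D" using m\<delta> D by (intro mult_right_mono) auto
      also have "\<dots> \<le> d\<^sub>0 * (a / 2) powr p"
      proof -
        have "\<delta> \<le> d\<^sub>0 * (a / 2) powr p / (2 * D)" by (simp add: \<delta>_def)
        then show ?thesis using D by (simp add: field_simps)
      qed
      finally show False using d\<^sub>0 a by simp
    qed
  qed
  with \<delta> that show thesis by blast
qed

end

section \<open>Uniform continuity in the direction \<open>e\<close> and the motion of the
  mirror\<close>

context indefinite_master
begin

text \<open>The penalty \<open>M * bump\<close> localises the maximum of \<open>u - u(\<cdot> + h e)\<close> to a unit ball, where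
  the right-hand side of the equation is bounded. Scales \<open>r \<ge> \<rho>\<close> see a small difference because
  the Gaussian smooths, and scales \<open>r \<le> \<rho>\<close> contribute little at a maximum.\<close>

lemma u_modulus:
  assumes "0 < \<delta>" and A: "0 \<le> A"
  obtains h\<^sub>0 where "0 < h\<^sub>0"
    and "\<And>x t h. \<bar>x \<bullet> e\<bar> \<le> A \<Longrightarrow> 0 \<le> h \<Longrightarrow> h \<le> h\<^sub>0 \<Longrightarrow> u x t - u (x + h *\<^sub>R e) t \<le> \<delta>"
proof -
  \<comment> \<open>Penalty cost plus the right-hand side: the two points satisfy
    \<open>\<bar>x \<bullet> e\<bar> \<le> A + 1\<close> and \<open>\<le> A + 2\<close>, whence
    \<open>2 * A + 3\<close>.\<close>
  define R where "R = M * bump_const TYPE('a) s + (2 * A + 3) * M powr p / K"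
  define \<rho> where "\<rho> = (\<delta> / (4 * s * R)) powr (1 / s)"
  define \<eta> where "\<eta> = \<delta> / 4"
  \<comment> \<open>The logarithm makes the exponential in the shift estimate at most
    \<open>1 + (\<eta> / M)\<^sup>2\<close> at all scales \<open>r \<ge> \<rho>\<close>; the cap 1
    keeps the translated point in the slab \<open>A + 2\<close>.\<close>
  define h\<^sub>0 where "h\<^sub>0 = min 1 (sqrt (2 * \<rho> * ln (1 + (\<eta> / M)\<^sup>2)))"
  have M: "0 < M" by (rule M_pos)
  have R: "0 < R"
    unfolding R_def using M bump_const_pos[OF s, where 'a='a] A K by (intro add_pos_nonneg) auto
  have \<rho>: "0 < \<rho>" using assms s R by (simp add: \<rho>_def)
  have \<rho>s: "s * R * \<rho> powr s = \<delta> / 4" using assms s R by (simp add: \<rho>_def powr_powr)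
  have \<eta>: "0 < \<eta>" using assms by (simp add: \<eta>_def)
  have ln: "0 < ln (1 + (\<eta> / M)\<^sup>2)" using \<eta> M by (intro ln_gt_zero) simp
  have h\<^sub>0: "0 < h\<^sub>0" "h\<^sub>0 \<le> 1" "h\<^sub>0\<^sup>2 \<le> 2 * \<rho> * ln (1 + (\<eta> / M)\<^sup>2)"
  proof -
    have "0 \<le> 2 * \<rho> * ln (1 + (\<eta> / M)\<^sup>2)" using \<rho> ln by simp
    moreover show pos: "0 < h\<^sub>0" using \<rho> ln by (simp add: h\<^sub>0_def)
    moreover have "h\<^sub>0\<^sup>2 \<le> (sqrt (2 * \<rho> * ln (1 + (\<eta> / M)\<^sup>2)))\<^sup>2"
      using pos by (intro power_mono) (auto simp: h\<^sub>0_def)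
    ultimately show "h\<^sub>0\<^sup>2 \<le> 2 * \<rho> * ln (1 + (\<eta> / M)\<^sup>2)" by simp
  qed (simp add: h\<^sub>0_def)
  have "u x\<^sub>0 t\<^sub>0 - u (x\<^sub>0 + h *\<^sub>R e) t\<^sub>0 \<le> \<delta>"
    if x\<^sub>0: "\<bar>x\<^sub>0 \<bullet> e\<bar> \<le> A" and h: "0 \<le> h" "h \<le> h\<^sub>0" for x\<^sub>0 t\<^sub>0 h
  proof (rule ccontr)
    assume neg: "\<not> u x\<^sub>0 t\<^sub>0 - u (x\<^sub>0 + h *\<^sub>R e) t\<^sub>0 \<le> \<delta>"
    define F where "F = (\<lambda>x t. u (x + h *\<^sub>R e) t - u x t)"
    have F_abs: "\<bar>F x t\<bar> < M" for x t
      using pos[of x t] le_M[of x t] pos[of "x + h *\<^sub>R e" t] le_M[of "x + h *\<^sub>R e" t]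
      by (simp add: F_def)
    have F\<^sub>0: "F x\<^sub>0 t\<^sub>0 < - \<delta>" using neg by (simp add: F_def)
    have F_cont: "continuous_on UNIV (\<lambda>(x, t). F x t)"
      unfolding F_def split_def by (intro continuous_intros)
    \<comment> \<open>The penalty height \<open>M\<close> dominates the depth of \<open>F\<close>,
      so any point where \<open>F\<close> is negative can serve as centre.\<close>
    have F_near: "F x\<^sub>0 t\<^sub>0 - M \<le> F x t" for x t
      using F_abs[of x t] F\<^sub>0 \<open>0 < \<delta>\<close> by linarith
    obtain x t where min: "\<And>y \<tau>. F x t + M * bump x\<^sub>0 t\<^sub>0 x t \<le> F y \<tau> + M * bump x\<^sub>0 t\<^sub>0 y \<tau>"
      by (rule attains_min_plus_bump[OF F_cont closed_UNIV UNIV_I less_imp_le[OF M] F_near]) auto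
    have at_x: "F x t + M * bump x\<^sub>0 t\<^sub>0 x t < - \<delta>" using min[of x\<^sub>0 t\<^sub>0] F\<^sub>0 by simp
    have "0 \<le> M * bump x\<^sub>0 t\<^sub>0 x t" using M by (simp add: bump_nonneg)
    then have Fx: "F x t < - \<delta>" using at_x by simp
    \<comment> \<open>With the full penalty the value would exceed 0, so the minimum lies within
      distance 1 of the centre.\<close>
    have "bump x\<^sub>0 t\<^sub>0 x t \<noteq> 1"
      using at_x F_abs[of x t] \<open>0 < \<delta>\<close> by (intro notI) simp
    then have "(norm (x - x\<^sub>0))\<^sup>2 < 1\<^sup>2" by (auto simp: bump_def min_def split: if_splits)
    then have "norm (x - x\<^sub>0) < 1" by (rule power_less_imp_less_base) simp
    then have "\<bar>(x - x\<^sub>0) \<bullet> e\<bar> < 1"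
      using Basis_le_norm[OF e, of "x - x\<^sub>0"] by linarith
    then have xe: "\<bar>x \<bullet> e\<bar> \<le> A + 1" using x\<^sub>0 by (simp add: inner_diff_left)
    have heat_F: "heat F y \<tau> r = heat u (y + h *\<^sub>R e) \<tau> r - heat u y \<tau> r" for y \<tau> r
    proof -
      have 1: "u (y + sqrt r *\<^sub>R z + h *\<^sub>R e) (\<tau> - r) = u (y + h *\<^sub>R e + sqrt r *\<^sub>R z) (\<tau> - r)" for z
        by (simp add: add_ac)
      show ?thesis
        unfolding heat_def F_def 1
        by (intro Bochner_Integration.integral_diff integrable_u) auto
    qed
    note F_eq = diff_eq[of F x t "x + h *\<^sub>R e" x, OF _ heat_F]
    have large: "\<bar>heat F x t r\<bar> \<le> \<eta>" if r: "\<rho> \<le> r" for r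
    proof -
      let ?a = "\<lambda>z. u (x + sqrt r *\<^sub>R z) (t - r)"
      \<comment> \<open>Translating \<open>x\<close> by \<open>h\<close> means translating the
        Gaussian variable by \<open>h / sqrt r\<close>, which is small at large scales.\<close>
      let ?b = "(h / sqrt r) *\<^sub>R e"
      have r0: "0 < r" using r \<rho> by simp
      have "?a (z + ?b) = u (x + h *\<^sub>R e + sqrt r *\<^sub>R z) (t - r)" for z
        using r0 by (simp add: scaleR_add_right add_ac)
      then have "heat F x t r = (\<integral>z. ?a (z + ?b) \<partial>gauss) - (\<integral>z. ?a z \<partial>gauss)"
        unfolding heat_F by (simp add: heat_def)
      then have "\<bar>heat F x t r\<bar> = \<bar>(\<integral>z. ?a z \<partial>gauss) - (\<integral>z. ?a (z + ?b) \<partial>gauss)\<bar>"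
        by (simp add: abs_minus_commute)
      also have "\<dots> \<le> M * ((\<eta> / M) / 2 + (exp ((norm ?b)\<^sup>2 / 2) - 1) / (2 * (\<eta> / M)))"
        using pos le_M \<eta> M by (intro integral_gauss_shift_diff_le) (auto simp: abs_of_pos)
      also have "\<dots> \<le> M * ((\<eta> / M) / 2 + (\<eta> / M)\<^sup>2 / (2 * (\<eta> / M)))"
      proof -
        have "(norm ?b)\<^sup>2 = h\<^sup>2 / r" using e h r0 by (simp add: power_divide)
        also have "\<dots> \<le> h\<^sub>0\<^sup>2 / \<rho>"
          using h r \<rho> by (intro frac_le power_mono) auto
        also have "\<dots> \<le> 2 * ln (1 + (\<eta> / M)\<^sup>2)" using h\<^sub>0(3) \<rho> by (simp add: field_simps)
        finally have "exp ((norm ?b)\<^sup>2 / 2) \<le> exp (ln (1 + (\<eta> / M)\<^sup>2))" by simp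
        also have "\<dots> = 1 + (\<eta> / M)\<^sup>2" by (intro exp_ln add_pos_nonneg) auto
        finally show ?thesis
          using \<eta> M by (intro mult_left_mono add_left_mono divide_right_mono) auto
      qed
      also have "\<dots> = \<eta>" using \<eta> M by (simp add: field_simps power2_eq_square)
      finally show ?thesis .
    qed
    \<comment> \<open>Averaging the minimality inequality bounds the drop of \<open>F\<close> by
      \<open>M\<close> times the increase of the bump.\<close>
    have small: "F x t - heat F x t r \<le> M * (1 + gauss_variance TYPE('a)) * min 1 r" if r: "0 < r" for r
    proof -
      interpret prob_space "gauss :: 'a measure" by (rule prob_space_gauss)
      have iF: "integrable gauss (\<lambda>z. F (x + sqrt r *\<^sub>R z) (t - r))"
        unfolding F_def by (intro Bochner_Integration.integrable_diff integrable_u) auto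
      have ib: "integrable gauss (\<lambda>z. bump x\<^sub>0 t\<^sub>0 (x + sqrt r *\<^sub>R z) (t - r))"
        by (rule integrable_gauss_bounded[where B=1]) (auto simp: bump_nonneg bump_le_1)
      have "(\<integral>z. F x t + M * bump x\<^sub>0 t\<^sub>0 x t \<partial>(gauss :: 'a measure)) \<le>
          (\<integral>z. F (x + sqrt r *\<^sub>R z) (t - r) + M * bump x\<^sub>0 t\<^sub>0 (x + sqrt r *\<^sub>R z) (t - r) \<partial>gauss)"
        using iF ib min by (intro integral_mono) auto
      also have "\<dots> = heat F x t r + M * heat (bump x\<^sub>0 t\<^sub>0) x t r"
        unfolding heat_def using iF ib by simp
      also have "M * heat (bump x\<^sub>0 t\<^sub>0) x t r \<le>
          M * (bump x\<^sub>0 t\<^sub>0 x t + (1 + gauss_variance TYPE('a)) * min 1 r)"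
        using M heat_bump_le[OF r] by (intro mult_left_mono) auto
      finally show ?thesis using prob_space by (simp add: algebra_simps)
    qed
    have "F x t - heat F x t r \<le> M * (1 + gauss_variance TYPE('a)) * min 1 r - (if \<rho> \<le> r then - F x t - \<eta> else 0)"
      if r: "0 < r" for r
    proof (cases "\<rho> \<le> r")
      case True
      have "0 \<le> M * (1 + gauss_variance TYPE('a)) * min 1 r"
        using M gauss_variance_nonneg[where 'a='a] r by simp
      then show ?thesis using large[OF True] True by simp
    next
      case False
      then show ?thesis using small[OF r] by simp
    qed
    then have le: "integral {0<..} (\<lambda>r. r powr (- 1 - s) * (F x t - heat F x t r)) \<le>
        M * (1 + gauss_variance TYPE('a)) * (1 / (1 - s) + 1 / s) - (- F x t - \<eta>) * (\<rho> powr (- s) / s)"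
      by (intro integral_powr_le[where \<psi>="\<lambda>r. F x t - heat F x t r", OF s \<rho>] F_eq(1)) (auto simp: F_def)
    have f_le: "\<bar>y \<bullet> e * u y t powr p\<bar> \<le> B * M powr p" if "\<bar>y \<bullet> e\<bar> \<le> B" for y B
      unfolding abs_mult using that pos[of y t] le_M[of y t] p
      by (intro mult_mono) (auto intro!: powr_mono2)
    have "\<bar>(x + h *\<^sub>R e) \<bullet> e\<bar> \<le> A + 2"
      using xe h h\<^sub>0 e by (simp add: inner_add_left)
    from f_le[OF this] f_le[OF xe]
    have "- ((2 * A + 3) * M powr p) \<le>
        (x + h *\<^sub>R e) \<bullet> e * u (x + h *\<^sub>R e) t powr p - x \<bullet> e * u x t powr p"
      by (simp add: algebra_simps)
    also have "\<dots> = K * integral {0<..} (\<lambda>r. r powr (- 1 - s) * (F x t - heat F x t r))"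
      by (rule F_eq(2)) (simp add: F_def)
    also have "\<dots> \<le> K * (M * bump_const TYPE('a) s - (- F x t - \<eta>) * (\<rho> powr (- s) / s))"
      using le K by (intro mult_left_mono) (auto simp: bump_const_def mult.assoc)
    finally have "(- F x t - \<eta>) * (\<rho> powr (- s) / s) \<le> R"
      using K by (simp add: R_def field_simps)
    then have "(- F x t - \<eta>) \<le> s * R * \<rho> powr s"
      using s \<rho> by (simp add: powr_minus field_simps)
    then show False using Fx \<rho>s \<open>0 < \<delta>\<close> by (simp add: \<eta>_def)
  qed
  with h\<^sub>0(1) that show thesis by blast
qed

lemma w_nonneg:
  assumes "x \<bullet> e < l"
  shows "0 \<le> w l x t"
proof -
  define \<Lambda> where "\<Lambda> = max 1 l"
  have \<Lambda>: "0 < \<Lambda>" "l \<le> \<Lambda>" by (auto simp: \<Lambda>_def)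
  obtain \<delta> where \<delta>: "0 < \<delta>"
    and almost: "\<And>l x t. l \<le> \<Lambda> \<Longrightarrow> (\<And>x t. 0 < x \<bullet> e \<Longrightarrow> x \<bullet> e < l \<Longrightarrow> - \<delta> \<le> w l x t) \<Longrightarrow>
      x \<bullet> e < l \<Longrightarrow> 0 \<le> w l x t"
    using w_nonneg_if_almost[OF \<Lambda>(1)] by blast
  \<comment> \<open>The slab \<open>2 * \<Lambda>\<close> also contains the mirror images of strip
    points.\<close>
  obtain h where h: "0 < h"
    and modulus: "\<And>x t k. \<bar>x \<bullet> e\<bar> \<le> 2 * \<Lambda> \<Longrightarrow> 0 \<le> k \<Longrightarrow> k \<le> h \<Longrightarrow> u x t - u (x + k *\<^sub>R e) t \<le> \<delta>"
    using u_modulus[OF \<delta>, of "2 * \<Lambda>"] \<Lambda> by (metis less_imp_le mult_nonneg_nonneg zero_le_numeral)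
  \<comment> \<open>Both \<open>\<delta>\<close> and \<open>h\<close> are uniform over mirrors up to
    \<open>\<Lambda>\<close>, so finitely many steps of length \<open>h / 2\<close> reach
    \<open>l\<close>.\<close>
  have advance: "0 \<le> w l' x t" if "l' \<le> \<Lambda>" "l' \<le> real n * (h / 2)" "x \<bullet> e < l'" for n l' x t
    using that
  proof (induction n arbitrary: l' x t)
    \<comment> \<open>Here \<open>l' \<le> 0\<close>, and the strip
      \<open>0 < x \<bullet> e < l'\<close> is empty.\<close>
    case 0
    then show ?case by (intro almost) auto
  next
    case (Suc n)
    define l\<^sub>0 where "l\<^sub>0 = l' - h / 2"
    have IH: "0 \<le> w l\<^sub>0 y \<tau>" if "y \<bullet> e < l\<^sub>0" for y \<tau>
    proof (rule Suc.IH[OF _ _ that])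
      show "l\<^sub>0 \<le> \<Lambda>" using Suc.prems(1) h by (simp add: l\<^sub>0_def)
      show "l\<^sub>0 \<le> real n * (h / 2)" using Suc.prems(2) by (simp add: l\<^sub>0_def algebra_simps)
    qed
    show ?case
    proof (rule almost[OF Suc.prems(1) _ Suc.prems(3)])
      fix y \<tau> assume y: "0 < y \<bullet> e" "y \<bullet> e < l'"
      show "- \<delta> \<le> w l' y \<tau>"
      \<comment> \<open>To the left of the old mirror the two images of \<open>y\<close> differ by
        \<open>h\<close>, and the old image already dominates \<open>y\<close>. Otherwise
        \<open>y\<close> is within \<open>h / 2\<close> of the new mirror, hence within
        \<open>h\<close> of its image.\<close>
      proof (cases "y \<bullet> e < l\<^sub>0")
        case True
        let ?y = "reflect e l\<^sub>0 y"
        have "2 * (l' - y \<bullet> e) = 2 * (l\<^sub>0 - y \<bullet> e) + h" by (simp add: l\<^sub>0_def)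
        then have "reflect e l' y = ?y + h *\<^sub>R e"
          by (simp only: reflect_def scaleR_add_left add.assoc)
        moreover have "u ?y \<tau> - u (?y + h *\<^sub>R e) \<tau> \<le> \<delta>"
          using True y Suc.prems h e by (intro modulus) (auto simp: l\<^sub>0_def)
        ultimately show ?thesis using IH[OF True, of \<tau>] by (simp add: w_def)
      next
        case False
        then have "u y \<tau> - u (y + (2 * (l' - y \<bullet> e)) *\<^sub>R e) \<tau> \<le> \<delta>"
          using y Suc.prems \<Lambda> by (intro modulus) (auto simp: l\<^sub>0_def)
        then show ?thesis by (simp add: w_def reflect_def)
      qed
    qed
  qed
  obtain n where "l / (h / 2) \<le> real n" using real_arch_simple by blast
  then have "l \<le> real n * (h / 2)" using h by (simp add: field_simps)
  then show ?thesis using advance \<Lambda>(2) assms by blast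
qed

text \<open>The mirror through the midpoint exchanges the two points.\<close>

lemma strict_mono_direction:
  assumes "0 < k"
  shows "u x t < u (x + k *\<^sub>R e) t"
proof -
  have "0 < w (x \<bullet> e + k / 2) x t"
    using assms by (intro w_pos w_nonneg) auto
  then show ?thesis by (simp add: w_def reflect_def)
qed

end

theorem theorem1p1:
  fixes u :: "real ^ 'n \<Rightarrow> real \<Rightarrow> real" and s p :: real and one :: 'n
  assumes "0 < s" and "s < 1" and "1 < p"
    and "classical_solution s (\<lambda>x t v. x $ one * v powr p) u"
    and "\<And>x t. 0 < u x t"
    and "bdd_above (range (\<lambda>(x, t). u x t))"
  shows "\<forall>t x y. x $ one < y $ one \<longrightarrow> (\<forall>j. j \<noteq> one \<longrightarrow> x $ j = y $ j) \<longrightarrow> u x t < u y t"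
proof (intro allI impI)
  fix t and x y :: "real ^ 'n"
  assume lt: "x $ one < y $ one" and agree: "\<forall>j. j \<noteq> one \<longrightarrow> x $ j = y $ j"
  let ?e = "axis one 1 :: real ^ 'n"
  obtain \<alpha> where "parabolic_holder_loc \<alpha> u"
    and master: "\<And>x t. has_master s u x t (x $ one * u x t powr p)"
    using assms(4) unfolding classical_solution_def by blast
  then have cont: "continuous_on UNIV (\<lambda>(x, t). u x t)"
    by (intro parabolic_holder_loc_continuous)
  obtain M where le_M: "\<And>x t. u x t \<le> M"
    using assms(6) unfolding bdd_above_def by auto
  have bound: "\<bar>u x t\<bar> \<le> M" for x t
    using assms(5)[of x t] le_M[of x t] by simp
  interpret indefinite_master u ?e s p M "master_const TYPE('n) s * gauss_mass TYPE(real ^ 'n)"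
  proof
    show "?e \<in> Basis" by (simp add: axis_in_Basis_iff)
    show "0 < master_const TYPE('n) s * gauss_mass TYPE(real ^ 'n)"
      using master_const_pos[OF assms(1,2)] gauss_mass_pos by (intro mult_pos_pos)
    fix x t
    show "(\<lambda>r. r powr (- 1 - s) * (u x t - heat u x t r)) integrable_on {0<..}"
      by (rule has_master_heat(1)[OF cont bound master])
    show "x \<bullet> ?e * u x t powr p = master_const TYPE('n) s * gauss_mass TYPE(real ^ 'n) *
        integral {0<..} (\<lambda>r. r powr (- 1 - s) * (u x t - heat u x t r))"
      using has_master_heat(2)[OF cont bound master] by (simp add: inner_axis)
  qed (use assms cont le_M in auto)
  have "y = x + (y $ one - x $ one) *\<^sub>R ?e"
    using agree by (simp add: vec_eq_iff axis_def)
  then show "u x t < u y t"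
    using strict_mono_direction[of "y $ one - x $ one" x t] lt by simp
qed

end
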